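(* Fix $k\ge1$ and let $G_k(z,u)=\sum z^{\text{size}}u^{\#\text{leaves}}$, summed over all closed lambda-terms in which every De Bruijn index is at most $k$. Define $c_1(u)=1$ and $c_j(u)=4(j-1)u-1+2\sqrt{c_{j-1}(u)}$ for $2\le j\le k+1$. Then there is $\delta>0$ such that, uniformly for $|u-1|<\delta$, \[ [z^n]G_k(z,u)=\sqrt{\frac{\sqrt{ku}+2ku}{4\pi\prod_{l=2}^{k+1}c_l(u)}}\,(1+2\sqrt{ku})^n\,n^{-3/2}\left(1+O\!\left(\frac{1}{\sqrt n}\right)\right),\qquad n\to\infty. \]
   Context: Lambda-terms are considered modulo $\alpha$-equivalence and represented by their skeleton, a rooted plane unary-binary tree (leaves = variables, unary nodes = abstractions, binary nodes = applications); size = total number of nodes. The De Bruijn index of a variable occurrence is the number of unary nodes on the path from the leaf up to and including its binding abstraction. Closed lambda-terms with all De Bruijn indices at most $k$ correspond bijectively to rooted plane unary-binary trees in which every leaf with $L$ unary ancestors ($L\ge1$) carries a label from $\{1,\dots,\min(L,k)\}$. Explicitly, $G_k(z,u)=\frac{1-\sqrt{\hat R_{k+1,k}(z,u)}}{2z}$ with $\hat R_{1,k}=(1-z)^2-4kuz^2$, $\hat R_{2,k}=1-4(k-1)z^2u-2z+2z^2+2z\sqrt{\hat R_{1,k}}$, and $\hat R_{i,k}=1-4(k-i+1)z^2u-2z+2z\sqrt{\hat R_{i-1,k}}$ for $3\le i\le k+1$. Square roots are principal branches. *)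

theory Defs
  imports Complex_Main "HOL-Computational_Algebra.Formal_Power_Series"
begin

text \<open>
  Lambda-terms modulo \<open>\<alpha>\<close>-equivalence are represented in De Bruijn form: unary-binary trees whose
  leaves carry their De Bruijn index. Indices start at 1, as the abstraction binding the variable
  is itself counted.
\<close>

datatype lterm = Var nat | Abs lterm | App lterm lterm

primrec nodes :: "lterm \<Rightarrow> nat" where
  "nodes (Var i) = 1"
| "nodes (Abs t) = 1 + nodes t"
| "nodes (App s t) = 1 + nodes s + nodes t"

primrec leaves :: "lterm \<Rightarrow> nat" where
  "leaves (Var i) = 1"
| "leaves (Abs t) = leaves t"
| "leaves (App s t) = leaves s + leaves t"

primrec indices :: "lterm \<Rightarrow> nat set" where
  "indices (Var i) = {i}"
| "indices (Abs t) = indices t"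
| "indices (App s t) = indices s \<union> indices t"

text \<open>Every variable of the term is bound when the term is placed under \<open>L\<close> further abstractions.\<close>

primrec closed_under :: "nat \<Rightarrow> lterm \<Rightarrow> bool" where
  "closed_under L (Var i) \<longleftrightarrow> 1 \<le> i \<and> i \<le> L"
| "closed_under L (Abs t) \<longleftrightarrow> closed_under (L + 1) t"
| "closed_under L (App s t) \<longleftrightarrow> closed_under L s \<and> closed_under L t"

definition closed_lterms :: "nat \<Rightarrow> lterm set" where
  "closed_lterms k = {t. closed_under 0 t \<and> (\<forall>i\<in>indices t. i \<le> k)}"

lemma finite_closed_lterms_nodes: "finite {t \<in> closed_lterms k. nodes t = n}"
proof -
  have "finite {t. (\<forall>i\<in>indices t. i \<le> k) \<and> nodes t \<le> m}" (is "finite (?A m)") for m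
  proof (induction m)
    case 0
    have "\<not> nodes t \<le> 0" for t by (cases t) auto
    then have "?A 0 = {}" by blast
    then show ?case by (simp only: finite.emptyI)
  next
    case (Suc m)
    have "?A (Suc m) \<subseteq> Var ` {..k} \<union> Abs ` ?A m \<union> (\<lambda>(s, t). App s t) ` (?A m \<times> ?A m)"
    proof
      fix t assume "t \<in> ?A (Suc m)"
      then show "t \<in> Var ` {..k} \<union> Abs ` ?A m \<union> (\<lambda>(s, t). App s t) ` (?A m \<times> ?A m)"
        by (cases t) (auto simp: image_iff)
    qed
    then show ?case
      by (rule finite_subset) (intro finite_UnI finite_imageI finite_cartesian_product Suc.IH finite_atMost)
  qed
  from this[of n] show ?thesis
    by (rule rev_finite_subset) (auto simp: closed_lterms_def)
qed

text \<open>
  The series \<open>G\<^sub>k(z,u)\<close> as a formal power series in \<open>z\<close>, for a given complex \<open>u\<close>. Its coefficients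
  are finite sums by \<open>finite_closed_lterms_nodes\<close>.
\<close>

definition G_series :: "nat \<Rightarrow> complex \<Rightarrow> complex fps" where
  "G_series k u = Abs_fps (\<lambda>n. \<Sum>t\<in>{t \<in> closed_lterms k. nodes t = n}. u ^ leaves t)"

text \<open>Only the values for \<open>j \<ge> 1\<close> are meaningful.\<close>

fun c_seq :: "nat \<Rightarrow> complex \<Rightarrow> complex" where
  "c_seq j u = (if j \<le> 1 then 1 else 4 * of_nat (j - 1) * u - 1 + 2 * csqrt (c_seq (j - 1) u))"

declare c_seq.simps [simp del]

end

theory Submission
  imports Defs "HOL-Analysis.Analysis" "HOL-Real_Asymp.Real_Asymp"
begin

text \<open>
  Let \<open>T\<^sub>L\<close> be the generating function of the terms that become closed under \<open>L\<close> abstractions, so that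
  \<open>T\<^sub>L = z (L u + T\<^sub>L\<^sub>+\<^sub>1 + T\<^sub>L\<^sup>2)\<close> for \<open>L < k\<close> and \<open>T\<^sub>k = z (k u + T\<^sub>k + T\<^sub>k\<^sup>2)\<close>. After rescaling \<open>z\<close> by
  \<open>\<rho> = 1 / (1 + 2 sqrt (k u))\<close>, only the last equation is critical at \<open>z = 1\<close>: its discriminant is
  \<open>(1 - z) (1 + \<beta> z)\<close> with \<open>\<bar>\<beta>\<bar> < 1\<close>. The others transfer the singularity of \<open>T\<^sub>L\<^sub>+\<^sub>1\<close> to \<open>T\<^sub>L\<close>. With
  \<open>P = 2 \<rho> z T\<^sub>L(\<rho> z)\<close> one has \<open>(1 - P)\<^sup>2 = 1 - 2 g\<close>, where \<open>g\<close> is affine in \<open>T\<^sub>L\<^sub>+\<^sub>1\<close>, hence \<open>P' = g' Q\<close> with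
  \<open>Q = 1 / (1 - P)\<close>. No contour integral is needed: power series with coefficients \<open>O(n\<^bsup>-3/2\<^esup>)\<close> form an
  algebra, and multiplying a series with coefficients \<open>\<kappa> n\<^bsup>-1/2\<^esup> + O(n\<^bsup>-1\<^esup>)\<close> by an element \<open>q\<close> of it replaces
  \<open>\<kappa>\<close> by \<open>\<kappa> q(1)\<close>. That \<open>Q\<close> lies in this algebra uniformly in \<open>u\<close> follows from \<open>\<Sum>\<bar>g\<^sub>n\<bar> < 1/2\<close>, which
  holds at \<open>u = 1\<close> because \<open>g\<close> then has nonnegative coefficients, and persists nearby by dominated
  convergence.
\<close>

section \<open>Convolutions of powers of \<open>n\<^bsup>-1/2\<^esup>\<close>\<close>

definition rsq :: "nat \<Rightarrow> real" where
  "rsq n = 1 / sqrt (real n + 1)"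

text \<open>The coefficients of \<open>(1 - z)\<^bsup>-1/2\<^esup>\<close>.\<close>

definition isqrt_coeff :: "nat \<Rightarrow> real" where
  "isqrt_coeff n = pochhammer (1/2) n / fact n"

lemma rsq_pos: "rsq n > 0"
  by (simp add: rsq_def)

lemma rsq_nonneg [simp]: "rsq n \<ge> 0"
  by (simp add: rsq_def)

lemma rsq_le_1: "rsq n \<le> 1"
  by (simp add: rsq_def)

lemma rsq_power2: "rsq n ^ 2 = 1 / (real n + 1)"
  by (simp add: rsq_def power_divide)

lemma rsq_mono: "m \<le> n \<Longrightarrow> rsq n \<le> rsq m"
  by (simp add: rsq_def frac_le)

text \<open>In a convolution, a factor whose index is at least a fixed fraction of \<open>n\<close>
  may be evaluated at \<open>n\<close> at the cost of a constant.\<close>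

lemma rsq_scale:
  assumes "real n + 1 \<le> c * (real m + 1)" "c > 0"
  shows "rsq m \<le> sqrt c * rsq n"
proof -
  have "sqrt (real n + 1) \<le> sqrt c * sqrt (real m + 1)"
    using assms by (metis real_sqrt_le_mono real_sqrt_mult)
  then show ?thesis
    using assms by (simp add: rsq_def field_simps)
qed

text \<open>Discrete counterpart of the derivative of x^(-1/2); it bounds sums and tails of
  \<open>rsq n ^ 3\<close> by telescoping.\<close>

lemma rsq_cube_telescope: "rsq (Suc n) ^ 3 \<le> 2 * (rsq n - rsq (Suc n))"
proof -
  define a b where "a = sqrt (real n + 1)" and "b = sqrt (real n + 2)"
  have ab: "a > 0" "a \<le> b" "b ^ 2 = a ^ 2 + 1"
    by (auto simp: a_def b_def)
  then have b: "b > 0" by linarith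
  have r: "rsq n = 1 / a" "rsq (Suc n) = 1 / b"
    by (auto simp: rsq_def a_def b_def add.commute)
  have "(b - a) * (b + a) = 1"
    using ab(3) by (simp add: power2_eq_square algebra_simps)
  then have d: "b - a = 1 / (b + a)"
    using ab by (simp add: field_simps)
  have "(b + a) * a \<le> (b + b) * b"
    using ab b by (intro mult_mono) auto
  then have "(b + a) * a * b \<le> (b + b) * b * b"
    using b by (intro mult_right_mono) auto
  then have "2 / ((b + b) * b * b) \<le> 2 / ((b + a) * a * b)"
    using ab b by (intro divide_left_mono mult_pos_pos add_pos_pos) auto
  also have "2 / ((b + a) * a * b) = 2 * ((b - a) / (a * b))"
    unfolding d using ab b by (simp add: field_simps)
  also have "(b - a) / (a * b) = 1 / a - 1 / b"
    using ab b by (simp add: field_simps)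
  finally show ?thesis
    using b by (simp add: r field_simps power3_eq_cube)
qed

lemma sum_rsq_cube_shift_le: "(\<Sum>m<M. rsq (m + Suc n) ^ 3) \<le> 2 * (rsq n - rsq (n + M))"
proof (induction M)
  case (Suc M)
  then show ?case
    using rsq_cube_telescope[of "n + M"] by (simp add: add_ac)
qed simp

text \<open>The telescoped bound does not grow with the number of terms, which yields summability
  and the tail estimate together. A tail of order n^(-1/2) makes the truncation error in
  \<open>norm_rsq_fps_mult_le\<close> of order 1/n.\<close>

lemma
  shows summable_rsq_cube: "summable (\<lambda>n. rsq n ^ 3)"
    and rsq_cube_tail_le: "(\<Sum>m. rsq (m + Suc n) ^ 3) \<le> 2 * rsq n"
proof -
  have le: "(\<Sum>m<M. rsq (m + Suc n) ^ 3) \<le> 2 * rsq n" for M n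
    using order_trans[OF sum_rsq_cube_shift_le[of n M], of "2 * rsq n"] by simp
  have s: "summable (\<lambda>m. rsq (m + Suc n) ^ 3)" for n
    by (rule summableI_nonneg_bounded[OF _ le]) simp
  from s[of 0] show "summable (\<lambda>n. rsq n ^ 3)"
    using summable_iff_shift[of "\<lambda>n. rsq n ^ 3" 1] by simp
  show "(\<Sum>m. rsq (m + Suc n) ^ 3) \<le> 2 * rsq n"
    by (rule suminf_le_const[OF s le])
qed

lemma sum_rsq_cube_le: "(\<Sum>i\<le>n. rsq i ^ 3) \<le> 3"
proof -
  have "(\<Sum>i\<le>n. rsq i ^ 3) \<le> (\<Sum>i. rsq i ^ 3)"
    by (rule sum_le_suminf[OF summable_rsq_cube]) auto
  also have "\<dots> = rsq 0 ^ 3 + (\<Sum>i. rsq (i + Suc 0) ^ 3)"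
    using suminf_split_head[OF summable_rsq_cube] by simp
  also have "\<dots> \<le> 3"
    using rsq_cube_tail_le[of 0] by (simp add: rsq_def)
  finally show ?thesis .
qed

lemma sum_rsq_cube_rev_le: "(\<Sum>i\<le>n. rsq (n - i) ^ 3) \<le> 3"
  using sum_rsq_cube_le[of n] sum.nat_diff_reindex[of "\<lambda>i. rsq i ^ 3" "Suc n"]
  by (simp add: lessThan_Suc_atMost)

text \<open>One of \<open>i + 1\<close> and \<open>n - i + 1\<close> is at least half of
  \<open>n + 1\<close>, so the corresponding cube is at most 2^(3/2) \<le> 4 times
  \<open>rsq n ^ 3\<close>. The sum on the right covers both cases.\<close>

lemma rsq_cube_mult_le:
  assumes "i \<le> n"
  shows "rsq i ^ 3 * rsq (n - i) ^ 3 \<le> 4 * rsq n ^ 3 * (rsq i ^ 3 + rsq (n - i) ^ 3)"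
proof -
  have s: "sqrt 2 ^ 3 \<le> (4::real)"
  proof -
    have "sqrt 2 ^ 3 = 2 * sqrt (2::real)" by (simp add: power3_eq_cube)
    also have "sqrt 2 \<le> (2::real)" by (rule real_le_lsqrt) auto
    finally show ?thesis by simp
  qed
  have aux: "rsq k ^ 3 \<le> 4 * rsq n ^ 3" if "real n + 1 \<le> 2 * (real k + 1)" for k
  proof -
    have "rsq k ^ 3 \<le> (sqrt 2 * rsq n) ^ 3"
      using that by (intro power_mono rsq_scale) auto
    also have "\<dots> \<le> 4 * rsq n ^ 3"
      unfolding power_mult_distrib by (intro mult_right_mono s) auto
    finally show ?thesis .
  qed
  have "real n + 1 \<le> 2 * (real i + 1) \<or> real n + 1 \<le> 2 * (real (n - i) + 1)"
    using assms by (auto simp: of_nat_diff)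
  then show ?thesis
  proof
    assume "real n + 1 \<le> 2 * (real i + 1)"
    from mult_right_mono[OF aux[OF this], of "rsq (n - i) ^ 3"] show ?thesis
      by (simp add: distrib_left add_increasing)
  next
    assume "real n + 1 \<le> 2 * (real (n - i) + 1)"
    from mult_left_mono[OF aux[OF this], of "rsq i ^ 3"] show ?thesis
      by (simp add: distrib_left add_increasing2 mult_ac)
  qed
qed

text \<open>This closes the series with coefficients O(n^(-3/2)) under products; 24 is 4 * (3 +
  3).\<close>

lemma conv_cube_cube: "(\<Sum>i\<le>n. rsq i ^ 3 * rsq (n - i) ^ 3) \<le> 24 * rsq n ^ 3"
proof -
  have "(\<Sum>i\<le>n. rsq i ^ 3 * rsq (n - i) ^ 3) \<le> (\<Sum>i\<le>n. 4 * rsq n ^ 3 * (rsq i ^ 3 + rsq (n - i) ^ 3))"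
    by (intro sum_mono rsq_cube_mult_le) auto
  also have "\<dots> = 4 * rsq n ^ 3 * ((\<Sum>i\<le>n. rsq i ^ 3) + (\<Sum>i\<le>n. rsq (n - i) ^ 3))"
    by (simp only: sum_distrib_left[symmetric] sum.distrib)
  also have "\<dots> \<le> 4 * rsq n ^ 3 * (3 + 3)"
    by (intro mult_left_mono add_mono sum_rsq_cube_le sum_rsq_cube_rev_le) auto
  finally show ?thesis by simp
qed

section \<open>Size of the coefficients of the inverse square root\<close>

lemma isqrt_coeff_pos: "isqrt_coeff n > 0"
  by (simp add: isqrt_coeff_def pochhammer_pos)

lemma isqrt_coeff_Suc: "isqrt_coeff (Suc n) = isqrt_coeff n * ((2 * real n + 1) / (2 * real n + 2))"
proof -
  have "isqrt_coeff (Suc n) = pochhammer (1/2) n * (1/2 + real n) / (fact n * (real n + 1))"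
    by (simp add: isqrt_coeff_def pochhammer_Suc algebra_simps)
  then show ?thesis
    by (simp add: isqrt_coeff_def field_simps)
qed

text \<open>Stated for any real field: the real instance feeds Vandermonde's identity, the complex
  one the binomial series.\<close>

lemma isqrt_coeff_gbinomial: "of_real (isqrt_coeff n) = (-1) ^ n * ((-1/2 :: 'a :: {real_field}) gchoose n)"
proof -
  have "(-1) ^ n * ((-1/2 :: 'a) gchoose n) = pochhammer (1/2) n / fact n"
    by (simp add: gbinomial_pochhammer flip: power_mult_distrib mult.assoc)
  also have "\<dots> = of_real (isqrt_coeff n)"
    using pochhammer_of_real[of "1/2" n, where 'a = 'a] by (simp add: isqrt_coeff_def)
  finally show ?thesis ..
qed

text \<open>The square of (1 - z)^(-1/2) is 1 / (1 - z): Vandermonde's identity with upper arguments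
  -1/2 and -1/2, whose sum is -1.\<close>

lemma sum_isqrt_coeff_isqrt_coeff: "(\<Sum>i\<le>n. isqrt_coeff i * isqrt_coeff (n - i)) = 1"
proof -
  have b: "isqrt_coeff i = (-1) ^ i * ((-1/2) gchoose i)" for i
    using isqrt_coeff_gbinomial[where 'a = real] by simp
  have "(\<Sum>i\<le>n. isqrt_coeff i * isqrt_coeff (n - i)) = (\<Sum>i\<le>n. (-1) ^ n * (((-1/2) gchoose i) * ((-1/2) gchoose (n - i))))"
    unfolding b by (intro sum.cong refl) (auto simp: mult_ac simp flip: power_add)
  also have "\<dots> = (-1) ^ n * ((-1/2 + -1/2) gchoose n)"
    unfolding sum_distrib_left[symmetric] gbinomial_Vandermonde[symmetric]
    by (simp add: atLeast0AtMost)
  also have "\<dots> = 1"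
    by (simp add: gbinomial_pochhammer pochhammer_fact[symmetric] flip: power_mult_distrib mult.assoc)
  finally show ?thesis .
qed

text \<open>Both sequences tend to 1 / \<pi>; the one with \<open>real n + 1\<close> decreases and
  the one with \<open>real n\<close> increases, so the limit bounds every term. The limit comes from
  the product formula for the reciprocal Gamma function at 1/2.\<close>

lemma isqrt_coeff_bounds:
  shows "1 / pi \<le> isqrt_coeff n ^ 2 * (real n + 1)" "isqrt_coeff n ^ 2 * real n \<le> 1 / pi"
proof -
  have "(\<lambda>n. (rGamma_series (1/2) n) ^ 2) \<longlonglongrightarrow> (rGamma (1/2 :: real)) ^ 2"
    by (intro tendsto_intros)
  moreover have "(rGamma (1/2 :: real)) ^ 2 = 1 / pi"
    by (simp add: rGamma_inverse_Gamma Gamma_one_half_real power_divide inverse_eq_divide)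
  \<comment> \<open>\<open>rGamma_series (1/2) n\<close> contains the Pochhammer symbol of length
    \<open>n + 1\<close>, hence the shift to \<open>Suc n\<close>.\<close>
  moreover have "eventually (\<lambda>n. (rGamma_series (1/2) n) ^ 2 = isqrt_coeff (Suc n) ^ 2 * (real n + 1) ^ 2 / real n) sequentially"
    using eventually_gt_at_top[of 0]
  proof eventually_elim
    case (elim n)
    have "exp (ln (real n) / 2) ^ 2 = real n"
      using elim by (simp add: power2_eq_square flip: exp_add)
    then show ?case
      using elim by (simp add: rGamma_series_def isqrt_coeff_def power_divide power_mult_distrib add.commute[of 1])
  qed
  ultimately have "(\<lambda>n. isqrt_coeff (Suc n) ^ 2 * (real n + 1) ^ 2 / real n) \<longlonglongrightarrow> 1 / pi"
    by (simp only: tendsto_cong)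
  note lim0 = this
  \<comment> \<open>Correction factors with limit 1; they turn
    \<open>(real n + 1) ^ 2 / real n\<close> into \<open>real n + 1\<close> and
    \<open>real n + 2\<close>.\<close>
  have "(\<lambda>n. real n / (real n + 1)) \<longlonglongrightarrow> 1" "(\<lambda>n. real n * (real n + 2) / (real n + 1)^2) \<longlonglongrightarrow> 1"
    by real_asymp+
  from this[THEN tendsto_mult[OF lim0]]
  have "(\<lambda>n. isqrt_coeff (Suc n) ^ 2 * (real n + 1) ^ 2 / real n * (real n / (real n + 1))) \<longlonglongrightarrow> 1 / pi"
    and "(\<lambda>n. isqrt_coeff (Suc n) ^ 2 * (real n + 1) ^ 2 / real n * (real n * (real n + 2) / (real n + 1)^2)) \<longlonglongrightarrow> 1 / pi"
    by simp_all
  note lim1 = this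
  have "(\<lambda>n. isqrt_coeff (Suc n) ^ 2 * real (Suc n)) \<longlonglongrightarrow> 1 / pi"
    by (rule Lim_transform_eventually[OF lim1(1)], use eventually_gt_at_top[of 0] in eventually_elim)
      (simp add: power2_eq_square divide_simps)
  moreover have "(\<lambda>n. isqrt_coeff (Suc n) ^ 2 * (real (Suc n) + 1)) \<longlonglongrightarrow> 1 / pi"
    by (rule Lim_transform_eventually[OF lim1(2)], use eventually_gt_at_top[of 0] in eventually_elim)
      (simp add: power2_eq_square divide_simps)
  ultimately have lim: "(\<lambda>n. isqrt_coeff n ^ 2 * real n) \<longlonglongrightarrow> 1 / pi"
    "(\<lambda>n. isqrt_coeff n ^ 2 * (real n + 1)) \<longlonglongrightarrow> 1 / pi"
    using filterlim_sequentially_Suc[of "\<lambda>n. isqrt_coeff n ^ 2 * real n" "nhds (1 / pi)"]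
      filterlim_sequentially_Suc[of "\<lambda>n. isqrt_coeff n ^ 2 * (real n + 1)" "nhds (1 / pi)"] by simp_all
  have "incseq (\<lambda>n. isqrt_coeff n ^ 2 * real n)"
  proof (rule incseq_SucI)
    fix n
    have "real n \<le> ((2 * real n + 1) / (2 * real n + 2)) ^ 2 * (real n + 1)"
      by (simp add: divide_simps power2_eq_square) (simp add: algebra_simps)
    from mult_left_mono[OF this, of "isqrt_coeff n ^ 2"]
    show "isqrt_coeff n ^ 2 * real n \<le> isqrt_coeff (Suc n) ^ 2 * real (Suc n)"
      unfolding isqrt_coeff_Suc power_mult_distrib by (simp add: mult_ac add_ac)
  qed
  from incseq_le[OF this lim(1)] show "isqrt_coeff n ^ 2 * real n \<le> 1 / pi" .
  have "decseq (\<lambda>n. isqrt_coeff n ^ 2 * (real n + 1))"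
  proof (rule decseq_SucI)
    fix n
    have "((2 * real n + 1) / (2 * real n + 2)) ^ 2 * (real n + 2) \<le> real n + 1"
      by (simp add: divide_simps power2_eq_square) (simp add: algebra_simps)
    from mult_left_mono[OF this, of "isqrt_coeff n ^ 2"]
    show "isqrt_coeff (Suc n) ^ 2 * (real (Suc n) + 1) \<le> isqrt_coeff n ^ 2 * (real n + 1)"
      unfolding isqrt_coeff_Suc power_mult_distrib by (simp add: mult_ac add_ac)
  qed
  from decseq_ge[OF this lim(2)] show "1 / pi \<le> isqrt_coeff n ^ 2 * (real n + 1)" .
qed

lemma isqrt_coeff_lower: "rsq n / sqrt pi \<le> isqrt_coeff n"
proof (rule power2_le_imp_le)
  show "(rsq n / sqrt pi)\<^sup>2 \<le> (isqrt_coeff n)\<^sup>2"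
    using isqrt_coeff_bounds(1)[of n] by (simp add: power_divide rsq_power2 divide_simps add_pos_nonneg mult.commute)
qed (use isqrt_coeff_pos[of n] in auto)

text \<open>
  The sum is a Riemann sum of a beta integral; comparison with \<open>(1 - z)\<^bsup>-1/2\<^esup> (1 - z)\<^bsup>-1/2\<^esup> = (1 - z)\<^bsup>-1\<^esup>\<close>
  bounds it without splitting the range.
\<close>

lemma conv_rsq_rsq: "(\<Sum>i\<le>n. rsq i * rsq (n - i)) \<le> 4"
proof -
  have r: "rsq i \<le> sqrt pi * isqrt_coeff i" for i
    using isqrt_coeff_lower[of i] by (simp add: field_simps)
  have "(\<Sum>i\<le>n. rsq i * rsq (n - i)) \<le> (\<Sum>i\<le>n. (sqrt pi * isqrt_coeff i) * (sqrt pi * isqrt_coeff (n - i)))"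
    using isqrt_coeff_pos by (intro sum_mono mult_mono r) (auto simp: less_imp_le)
  also have "\<dots> = pi * (\<Sum>i\<le>n. isqrt_coeff i * isqrt_coeff (n - i))"
  proof -
    have "(sqrt pi * a) * (sqrt pi * b) = (sqrt pi * sqrt pi) * (a * b)" for a b
      by (simp only: mult_ac)
    then show ?thesis by (simp only: sum_distrib_left) simp
  qed
  also have "\<dots> \<le> 4"
    using pi_less_4 by (simp add: sum_isqrt_coeff_isqrt_coeff)
  finally show ?thesis .
qed

text \<open>By \<open>isqrt_coeff_bounds\<close> the squares of the two quantities differ by
  O(n^(-2)); dividing by their sum gives the claim.\<close>

lemma isqrt_coeff_asymp: "\<bar>isqrt_coeff n - rsq n / sqrt pi\<bar> \<le> 2 * rsq n ^ 2"
proof -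
  define e where "e = rsq n / sqrt pi"
  have e: "e > 0" "e ^ 2 = rsq n ^ 2 / pi"
    by (auto simp: e_def rsq_pos power_divide)
  have "isqrt_coeff n ^ 2 \<le> 1"
  proof (cases "n = 0")
    case False
    then have "isqrt_coeff n ^ 2 \<le> isqrt_coeff n ^ 2 * real n"
      by (simp add: mult_le_cancel_left1)
    also have "\<dots> \<le> 1 / pi" by (rule isqrt_coeff_bounds)
    also have "\<dots> \<le> 1" using pi_gt3 by simp
    finally show ?thesis .
  qed (simp add: isqrt_coeff_def)
  then have "isqrt_coeff n ^ 2 * (real n + 1) \<le> 1 / pi + 1"
    using isqrt_coeff_bounds(2)[of n] by (simp add: distrib_left)
  moreover have "1 / pi \<le> 1" using pi_gt3 by simp
  ultimately have b1: "isqrt_coeff n ^ 2 * (real n + 1) \<le> 2" by linarith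
  have "isqrt_coeff n ^ 2 - e ^ 2 \<le> isqrt_coeff n ^ 2 * rsq n ^ 2"
    using isqrt_coeff_bounds(2)[of n] by (simp add: e rsq_power2 divide_simps add_pos_nonneg) (simp add: algebra_simps)
  also have "\<dots> \<le> 2 * rsq n ^ 2 * rsq n ^ 2"
    using b1 by (intro mult_right_mono) (auto simp: rsq_power2 field_simps)
  finally have d: "(isqrt_coeff n - e) * (isqrt_coeff n + e) \<le> 2 * rsq n ^ 2 * rsq n ^ 2"
    by (simp add: algebra_simps power2_eq_square)
  have le: "e \<le> isqrt_coeff n" unfolding e_def by (rule isqrt_coeff_lower)
  \<comment> \<open>The sum is really of order \<open>rsq n\<close>; this weaker lower bound
    suffices for an error of order 1/n.\<close>
  have "rsq n ^ 2 \<le> isqrt_coeff n + e"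
  proof -
    have "rsq n ^ 2 \<le> rsq n" using rsq_le_1[of n] by (simp add: power2_eq_square mult_le_cancel_left1 mult_left_le)
    also have "rsq n \<le> 2 * e"
      using rsq_pos[of n] pi_less_4 by (auto simp: e_def field_simps intro!: real_le_lsqrt)
    finally show ?thesis using le by simp
  qed
  then have "(isqrt_coeff n - e) * rsq n ^ 2 \<le> (isqrt_coeff n - e) * (isqrt_coeff n + e)"
    using le by (intro mult_left_mono) auto
  with d have "(isqrt_coeff n - e) * rsq n ^ 2 \<le> 2 * rsq n ^ 2 * rsq n ^ 2" by linarith
  then have "isqrt_coeff n - e \<le> 2 * rsq n ^ 2"
    using rsq_pos[of n] by (simp add: mult_le_cancel_right)
  with le show ?thesis by (simp add: e_def)
qed

text \<open>Multiplying by \<open>n + 1\<close>, which is at most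
  \<open>(i + 1) + (n - i + 1)\<close>, cancels powers of \<open>rsq\<close> and leaves two sums
  already bounded by 4 and 3. Hence series with O(1/n) coefficients form a module over the
  algebra.\<close>

lemma conv_sq_cube: "(\<Sum>i\<le>n. rsq i ^ 2 * rsq (n - i) ^ 3) \<le> 7 * rsq n ^ 2"
proof -
  have "(\<Sum>i\<le>n. rsq i ^ 2 * rsq (n - i) ^ 3) \<le> (\<Sum>i\<le>n. rsq n ^ 2 * (rsq i * rsq (n - i) + rsq (n - i) ^ 3))"
  proof (intro sum_mono)
    fix i assume "i \<in> {..n}"
    then have n: "real n + 1 \<le> (real i + 1) + (real (n - i) + 1)" by auto
    have [simp]: "real j + 1 \<noteq> 0" for j by (simp add: add_eq_0_iff)
    have "(real n + 1) * (rsq i ^ 2 * rsq (n - i) ^ 3)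
        \<le> ((real i + 1) + (real (n - i) + 1)) * (rsq i ^ 2 * rsq (n - i) ^ 3)"
      by (intro mult_right_mono n) auto
    also have "\<dots> = ((real i + 1) * rsq i ^ 2) * rsq (n - i) ^ 3 + rsq i ^ 2 * (((real (n - i) + 1) * rsq (n - i) ^ 2) * rsq (n - i))"
      by (simp only: power2_eq_square power3_eq_cube) (simp only: algebra_simps)
    also have "\<dots> = rsq (n - i) ^ 3 + rsq i ^ 2 * rsq (n - i)"
      by (simp only: rsq_power2) simp
    also have "\<dots> \<le> rsq (n - i) ^ 3 + rsq i * rsq (n - i)"
      using rsq_le_1[of i] by (intro add_mono mult_right_mono) (auto simp: power2_eq_square mult_left_le)
    finally show "rsq i ^ 2 * rsq (n - i) ^ 3 \<le> rsq n ^ 2 * (rsq i * rsq (n - i) + rsq (n - i) ^ 3)"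
      unfolding rsq_power2[of n] by (simp add: divide_simps add_pos_nonneg) (simp add: algebra_simps)
  qed
  also have "\<dots> = rsq n ^ 2 * ((\<Sum>i\<le>n. rsq i * rsq (n - i)) + (\<Sum>i\<le>n. rsq (n - i) ^ 3))"
    by (simp only: sum_distrib_left[symmetric] sum.distrib)
  also have "\<dots> \<le> rsq n ^ 2 * (4 + 3)"
    by (intro mult_left_mono add_mono conv_rsq_rsq sum_rsq_cube_rev_le) auto
  finally show ?thesis by simp
qed

text \<open>Error of replacing \<open>rsq (n - m)\<close> by \<open>rsq n\<close>: the difference is
  at most \<open>m / (x * N ^ 2)\<close>, and \<open>rsq m ^ 2\<close> absorbs the factor
  \<open>m\<close>. The right-hand side is then summed over \<open>m\<close> by
  \<open>conv_rsq_rsq\<close>.\<close>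

lemma rsq_cube_diff_le:
  assumes "m \<le> n"
  shows "rsq m ^ 3 * (rsq (n - m) - rsq n) \<le> rsq n ^ 2 * (rsq m * rsq (n - m))"
proof -
  define x N where "x = sqrt (real (n - m) + 1)" and "N = sqrt (real n + 1)"
  have xN: "x > 0" "x \<le> N" "N ^ 2 - x ^ 2 = real m"
    using assms by (auto simp: x_def N_def of_nat_diff)
  then have N: "N > 0" by linarith
  have r: "rsq (n - m) = 1 / x" "rsq n = 1 / N"
    by (simp_all add: x_def N_def rsq_def)
  have "(N - x) * N \<le> (N - x) * (N + x)"
    using xN N by (intro mult_left_mono) auto
  also have "\<dots> = real m" using xN(3) by (simp add: power2_eq_square algebra_simps)
  finally have "1 / x - 1 / N \<le> real m / (x * N ^ 2)"
    using xN(1) N by (simp add: divide_simps power2_eq_square)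
  then have "rsq m ^ 3 * (rsq (n - m) - rsq n) \<le> rsq m ^ 3 * (real m / (x * N ^ 2))"
    unfolding r by (intro mult_left_mono) auto
  also have "\<dots> = (rsq m ^ 2 * real m) * (rsq m / (x * N ^ 2))"
    by (simp add: power2_eq_square power3_eq_cube)
  also have "\<dots> \<le> 1 * (rsq m / (x * N ^ 2))"
    using xN N by (intro mult_right_mono) (auto simp: rsq_power2)
  also have "\<dots> = rsq n ^ 2 * (rsq m * rsq (n - m))"
    unfolding r by (simp add: power_divide)
  finally show ?thesis .
qed

section \<open>Composition with the inverse square root\<close>

definition isqrt_fps :: "complex fps" where
  "isqrt_fps = Abs_fps (\<lambda>n. of_real (isqrt_coeff n))"

lemma isqrt_fps_square: "isqrt_fps ^ 2 * (1 - fps_X) = 1"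
proof -
  have "isqrt_fps ^ 2 = Abs_fps (\<lambda>n. 1)"
  proof (rule fps_ext)
    fix n
    have "fps_nth (isqrt_fps ^ 2) n = of_real (\<Sum>i\<le>n. isqrt_coeff i * isqrt_coeff (n - i))"
      unfolding power2_eq_square fps_mult_nth atLeast0AtMost isqrt_fps_def of_real_sum
      by (rule sum.cong) simp_all
    then show "fps_nth (isqrt_fps ^ 2) n = fps_nth (Abs_fps (\<lambda>n. 1)) n"
      by (simp add: sum_isqrt_coeff_isqrt_coeff)
  qed
  moreover have "Abs_fps (\<lambda>n. 1 :: complex) * (1 - fps_X) = 1"
    by (rule fps_ext) (simp add: right_diff_distrib)
  ultimately show ?thesis by simp
qed

text \<open>A vanishing constant coefficient makes composition a ring homomorphism, so
  \<open>isqrt_fps oo h\<close> is (1 - h)^(-1/2).\<close>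

lemma isqrt_fps_compose_square:
  assumes "fps_nth h 0 = 0"
  shows "(isqrt_fps oo h) ^ 2 * (1 - h) = 1"
proof -
  have "(isqrt_fps ^ 2 * (1 - fps_X)) oo h = (isqrt_fps oo h) ^ 2 * (1 - h)"
    using assms by (simp add: fps_compose_mult_distrib fps_compose_power fps_compose_sub_distrib)
  then show ?thesis by (simp add: isqrt_fps_square)
qed

lemma fps_nth_isqrt_fps_compose:
  "fps_nth (isqrt_fps oo h) n = (\<Sum>i\<le>n. of_real (isqrt_coeff i) * fps_nth (h ^ i) n)"
  by (simp add: fps_compose_nth isqrt_fps_def atLeast0AtMost)

lemma norm_fps_mult_nth_le:
  "norm (fps_nth (f * g :: complex fps) n) \<le> (\<Sum>i\<le>n. norm (fps_nth f i) * norm (fps_nth g (n - i)))"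
  unfolding fps_mult_nth atLeast0AtMost by (rule sum_norm_le) (simp add: norm_mult)

text \<open>The triangle of index pairs lies in a square. This is submultiplicativity of the l1-norm
  at the level of partial sums.\<close>

lemma sum_norm_fps_mult_le:
  "(\<Sum>n\<le>N. norm (fps_nth (f * g :: complex fps) n)) \<le>
     (\<Sum>i\<le>N. norm (fps_nth f i)) * (\<Sum>i\<le>N. norm (fps_nth g i))"
proof -
  have "(\<Sum>n\<le>N. norm (fps_nth (f * g) n)) \<le> (\<Sum>n\<le>N. \<Sum>i\<le>n. norm (fps_nth f i) * norm (fps_nth g (n - i)))"
    by (intro sum_mono norm_fps_mult_nth_le)
  also have "\<dots> = (\<Sum>(i, j)\<in>{(i, j). i + j \<le> N}. norm (fps_nth f i) * norm (fps_nth g j))"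
    by (rule sum.triangle_reindex_eq[symmetric])
  also have "\<dots> \<le> (\<Sum>(i, j)\<in>{..N} \<times> {..N}. norm (fps_nth f i) * norm (fps_nth g j))"
    by (rule sum_mono2) auto
  also have "\<dots> = (\<Sum>i\<le>N. norm (fps_nth f i)) * (\<Sum>i\<le>N. norm (fps_nth g i))"
    by (simp add: sum_product sum.cartesian_product)
  finally show ?thesis .
qed

lemma sum_norm_fps_power_le:
  fixes h :: "complex fps"
  assumes "\<And>N. (\<Sum>i\<le>N. norm (fps_nth h i)) \<le> \<gamma>"
  shows "(\<Sum>i\<le>N. norm (fps_nth (h ^ m) i)) \<le> \<gamma> ^ m"
proof (induction m)
  case 0
  have "(\<Sum>i\<le>N. norm (fps_nth (1 :: complex fps) i)) = 1"
    by (simp add: if_distrib cong: if_cong)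
  then show ?case by simp
next
  case (Suc m)
  have \<gamma>: "0 \<le> \<gamma>"
    using assms[of 0] by (rule order_trans[rotated]) simp
  have "(\<Sum>i\<le>N. norm (fps_nth (h * h ^ m) i)) \<le> (\<Sum>i\<le>N. norm (fps_nth h i)) * (\<Sum>i\<le>N. norm (fps_nth (h ^ m) i))"
    by (rule sum_norm_fps_mult_le)
  also have "\<dots> \<le> \<gamma> * \<gamma> ^ m"
    by (intro mult_mono assms Suc \<gamma> sum_nonneg) auto
  finally show ?case by simp
qed

text \<open>
  In a product of \<open>m\<close> coefficients of total index \<open>n\<close>, some factor has index at least \<open>n / m\<close>;
  hence the power of \<open>m\<close> on the right is only polynomial.
\<close>

lemma norm_fps_power_nth_le:
  fixes h :: "complex fps"
  assumes K: "\<And>n. norm (fps_nth h n) \<le> K * rsq n ^ 3"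
    and \<gamma>: "\<And>N. (\<Sum>i\<le>N. norm (fps_nth h i)) \<le> \<gamma>"
  shows "norm (fps_nth (h ^ Suc m) n) \<le> K * (real (Suc m) * sqrt (real (Suc m)) ^ 3) * \<gamma> ^ m * rsq n ^ 3"
proof (induction m arbitrary: n)
  case 0
  then show ?case using K by simp
next
  case (Suc m)
  define s where "s = sqrt (real (Suc (Suc m))) ^ 3"
  define c where "c = K * s * rsq n ^ 3"
  define d where "d = K * (real (Suc m) * s) * \<gamma> ^ m * rsq n ^ 3"
  have \<gamma>0: "0 \<le> \<gamma>"
    using \<gamma>[of 0] by (rule order_trans[rotated]) simp
  have "0 \<le> norm (fps_nth h 0)" by simp
  also have "norm (fps_nth h 0) \<le> K" using K[of 0] by (simp add: rsq_def)
  finally have K0: "0 \<le> K" .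
  have s0: "s \<ge> 0" by (simp add: s_def)
  have cd: "c \<ge> 0" "d \<ge> 0" using K0 s0 \<gamma>0 by (auto simp: c_def d_def)
  have "norm (fps_nth (h * h ^ Suc m) n)
      \<le> (\<Sum>i\<le>n. norm (fps_nth h i) * norm (fps_nth (h ^ Suc m) (n - i)))"
    by (rule norm_fps_mult_nth_le)
  also have "\<dots> \<le> (\<Sum>i\<le>n. c * norm (fps_nth (h ^ Suc m) (n - i)) + norm (fps_nth h i) * d)"
  proof (rule sum_mono)
    fix i assume i: "i \<in> {..n}"
    show "norm (fps_nth h i) * norm (fps_nth (h ^ Suc m) (n - i))
        \<le> c * norm (fps_nth (h ^ Suc m) (n - i)) + norm (fps_nth h i) * d"
    proof (cases "real n + 1 \<le> real (Suc (Suc m)) * (real i + 1)")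
      case True
      then have "rsq i \<le> sqrt (real (Suc (Suc m))) * rsq n"
        by (rule rsq_scale) simp
      then have "rsq i ^ 3 \<le> s * rsq n ^ 3"
        unfolding s_def power_mult_distrib[symmetric] by (rule power_mono) simp
      then have "K * rsq i ^ 3 \<le> c"
        unfolding c_def mult.assoc by (rule mult_left_mono) (rule K0)
      with K[of i] have "norm (fps_nth h i) \<le> c" by linarith
      then have "norm (fps_nth h i) * norm (fps_nth (h ^ Suc m) (n - i))
          \<le> c * norm (fps_nth (h ^ Suc m) (n - i))"
        by (rule mult_right_mono) simp
      then show ?thesis using cd by (simp add: add_increasing2)
    next
      case False
      \<comment> \<open>In this case \<open>n - i + 1\<close> is at least
        \<open>(n + 1) / ?q\<close>, and \<open>sqrt ?q ^ 3\<close> turns the root of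
        \<open>m + 1\<close> in the induction hypothesis exactly into that of
        \<open>m + 2\<close>.\<close>
      let ?q = "real (Suc (Suc m)) / real (Suc m)"
      have "real n + 1 \<le> ?q * (real (n - i) + 1)"
        using False i by (simp add: field_simps of_nat_diff)
      then have "rsq (n - i) \<le> sqrt ?q * rsq n"
        by (rule rsq_scale) simp
      then have "rsq (n - i) ^ 3 \<le> sqrt ?q ^ 3 * rsq n ^ 3"
        unfolding power_mult_distrib[symmetric] by (rule power_mono) simp
      then have "K * (real (Suc m) * sqrt (real (Suc m)) ^ 3) * \<gamma> ^ m * rsq (n - i) ^ 3
          \<le> K * (real (Suc m) * sqrt (real (Suc m)) ^ 3) * \<gamma> ^ m * (sqrt ?q ^ 3 * rsq n ^ 3)"
        using K0 \<gamma>0 by (intro mult_left_mono mult_nonneg_nonneg) auto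
      also have "\<dots> = d"
        by (simp add: d_def s_def real_sqrt_divide power_divide del: of_nat_Suc)
      finally have "norm (fps_nth (h ^ Suc m) (n - i)) \<le> d"
        using Suc.IH[of "n - i"] by linarith
      then have "norm (fps_nth h i) * norm (fps_nth (h ^ Suc m) (n - i)) \<le> norm (fps_nth h i) * d"
        by (rule mult_left_mono) simp
      then show ?thesis using cd by (simp add: add_increasing)
    qed
  qed
  also have "\<dots> = c * (\<Sum>i\<le>n. norm (fps_nth (h ^ Suc m) (n - i))) + (\<Sum>i\<le>n. norm (fps_nth h i)) * d"
    by (simp only: sum.distrib sum_distrib_left sum_distrib_right)
  also have "(\<Sum>i\<le>n. norm (fps_nth (h ^ Suc m) (n - i))) = (\<Sum>i\<le>n. norm (fps_nth (h ^ Suc m) i))"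
    using sum.nat_diff_reindex[of "\<lambda>i. norm (fps_nth (h ^ Suc m) i)" "Suc n"]
    by (simp add: lessThan_Suc_atMost)
  also have "c * \<dots> + (\<Sum>i\<le>n. norm (fps_nth h i)) * d \<le> c * \<gamma> ^ Suc m + \<gamma> * d"
    using cd by (intro add_mono mult_left_mono mult_right_mono sum_norm_fps_power_le \<gamma>)
  also have "\<dots> = K * (real (Suc (Suc m)) * s) * \<gamma> ^ Suc m * rsq n ^ 3"
    by (simp add: c_def d_def algebra_simps)
  finally show ?case
    unfolding s_def by simp
qed

text \<open>Three termwise differentiations of the geometric series give the coefficients
  (m+1)(m+2)(m+3), which dominate the cube.\<close>

lemma summable_cube_geometric:
  fixes \<gamma> :: real
  assumes "0 \<le> \<gamma>" "\<gamma> < 1"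
  shows "summable (\<lambda>m. real (Suc m) ^ 3 * \<gamma> ^ m)"
proof -
  have 0: "summable (\<lambda>m. (\<lambda>_. 1) m * x ^ m)" if "norm x < 1" for x :: real
    using that by (simp add: summable_geometric)
  have 1: "summable (\<lambda>m. diffs (\<lambda>_. 1) m * x ^ m)" if "norm x < 1" for x :: real
    by (rule termdiff_converges[OF that 0])
  have 2: "summable (\<lambda>m. diffs (diffs (\<lambda>_. 1)) m * x ^ m)" if "norm x < 1" for x :: real
    by (rule termdiff_converges[OF that 1])
  have 3: "summable (\<lambda>m. diffs (diffs (diffs (\<lambda>_. 1))) m * x ^ m)" if "norm x < 1" for x :: real
    by (rule termdiff_converges[OF that 2])
  show ?thesis
  proof (rule summable_comparison_test'[OF 3])
    show "norm \<gamma> < 1" using assms by simp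
    fix m :: nat
    have "real (Suc m) ^ 3 = real (Suc m) * (real (Suc m) * real (Suc m))"
      by (simp add: power3_eq_cube)
    also have "\<dots> \<le> real (Suc m) * (real (Suc (Suc m)) * real (Suc (Suc (Suc m))))"
      by (intro mult_left_mono mult_mono) auto
    finally show "norm (real (Suc m) ^ 3 * \<gamma> ^ m) \<le> diffs (diffs (diffs (\<lambda>_. 1))) m * \<gamma> ^ m"
      using assms by (simp add: diffs_def abs_mult mult_right_mono)
  qed
qed

lemma isqrt_coeff_le_1: "isqrt_coeff n \<le> 1"
proof (induction n)
  case (Suc n)
  have "isqrt_coeff (Suc n) \<le> isqrt_coeff n * 1"
    unfolding isqrt_coeff_Suc using isqrt_coeff_pos[of n] by (intro mult_left_mono) auto
  with Suc show ?case by simp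
qed (simp add: isqrt_coeff_def)

text \<open>\<open>D\<close> depends on \<gamma> alone and is chosen before \<open>h\<close>,
  \<open>K\<close> and \<open>n\<close>; this later gives uniformity in \<open>u\<close>. The bounds
  of \<open>norm_fps_power_nth_le\<close> are summed over the powers of \<open>h\<close>, and the
  summand 1 accounts for \<open>h ^ 0\<close>.\<close>

lemma isqrt_fps_compose_bound:
  assumes "0 \<le> \<gamma>" "\<gamma> < 1"
  obtains D where "\<And>h K n. (\<And>n. norm (fps_nth h n) \<le> K * rsq n ^ 3) \<Longrightarrow>
      (\<And>N. (\<Sum>i\<le>N. norm (fps_nth h i)) \<le> \<gamma>) \<Longrightarrow>
      norm (fps_nth (isqrt_fps oo h) n) \<le> (1 + K * D) * rsq n ^ 3"
proof
  define D where "D = (\<Sum>m. real (Suc m) ^ 3 * \<gamma> ^ m)"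
  note summ = summable_cube_geometric[OF assms]
  fix h :: "complex fps" and K n
  assume K: "norm (fps_nth h n) \<le> K * rsq n ^ 3" for n
  assume \<gamma>: "(\<Sum>i\<le>N. norm (fps_nth h i)) \<le> \<gamma>" for N
  have "0 \<le> norm (fps_nth h 0)" by simp
  also have "norm (fps_nth h 0) \<le> K" using K[of 0] by (simp add: rsq_def)
  finally have K0: "0 \<le> K" .
  have le: "norm (of_real (isqrt_coeff i) * fps_nth (h ^ i) n) \<le> norm (fps_nth (h ^ i) n)" for i
    using isqrt_coeff_le_1[of i] isqrt_coeff_pos[of i] by (simp add: norm_mult mult_left_le_one_le)
  have "norm (fps_nth (isqrt_fps oo h) n) \<le> (\<Sum>i\<le>n. norm (fps_nth (h ^ i) n))"
    unfolding fps_nth_isqrt_fps_compose by (intro sum_norm_le le)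
  also have "\<dots> \<le> (\<Sum>i\<le>Suc n. norm (fps_nth (h ^ i) n))"
    by (intro sum_mono2) auto
  also have "\<dots> = norm (fps_nth (1 :: complex fps) n) + (\<Sum>m\<le>n. norm (fps_nth (h ^ Suc m) n))"
    by (subst sum.atMost_Suc_shift) simp
  also have "norm (fps_nth (1 :: complex fps) n) \<le> rsq n ^ 3"
    by (cases "n = 0") (auto simp: rsq_def)
  also have "(\<Sum>m\<le>n. norm (fps_nth (h ^ Suc m) n)) \<le> (\<Sum>m\<le>n. K * rsq n ^ 3 * (real (Suc m) ^ 3 * \<gamma> ^ m))"
  proof (intro sum_mono)
    fix m
    have s: "sqrt (real (Suc m)) ^ 3 \<le> real (Suc m) * real (Suc m)"
    proof -
      have "sqrt (real (Suc m)) \<le> real (Suc m)"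
        by (rule real_le_lsqrt) (auto simp: power2_eq_square)
      then have "real (Suc m) * sqrt (real (Suc m)) \<le> real (Suc m) * real (Suc m)"
        by (intro mult_left_mono) auto
      then show ?thesis by (simp add: power3_eq_cube del: of_nat_Suc)
    qed
    have "norm (fps_nth (h ^ Suc m) n) \<le> K * (real (Suc m) * sqrt (real (Suc m)) ^ 3) * \<gamma> ^ m * rsq n ^ 3"
      by (rule norm_fps_power_nth_le[OF K \<gamma>])
    also have "\<dots> \<le> K * (real (Suc m) * (real (Suc m) * real (Suc m))) * \<gamma> ^ m * rsq n ^ 3"
      using assms K0 by (intro mult_right_mono mult_left_mono s) auto
    finally show "norm (fps_nth (h ^ Suc m) n) \<le> K * rsq n ^ 3 * (real (Suc m) ^ 3 * \<gamma> ^ m)"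
      by (simp only: power3_eq_cube mult_ac)
  qed
  also have "\<dots> = K * rsq n ^ 3 * (\<Sum>m\<le>n. real (Suc m) ^ 3 * \<gamma> ^ m)"
    by (rule sum_distrib_left[symmetric])
  also have "\<dots> \<le> K * rsq n ^ 3 * D"
    unfolding D_def using K0 assms by (intro mult_left_mono sum_le_suminf summ) auto
  finally show "norm (fps_nth (isqrt_fps oo h) n) \<le> (1 + K * D) * rsq n ^ 3"
    by (simp add: algebra_simps)
qed

section \<open>Absolutely summable power series\<close>

text \<open>The value at z = 1, the rescaled singularity. It is meaningful for convergent series
  only, so the arithmetic rules carry \<open>abs_summable\<close>.\<close>

definition fps_ev :: "complex fps \<Rightarrow> complex" where
  "fps_ev f = (\<Sum>n. fps_nth f n)"

definition abs_summable :: "complex fps \<Rightarrow> bool" where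
  "abs_summable f \<longleftrightarrow> summable (\<lambda>n. norm (fps_nth f n))"

lemma abs_summable_imp_summable: "abs_summable f \<Longrightarrow> summable (fps_nth f)"
  unfolding abs_summable_def by (rule summable_norm_cancel)

lemma abs_summable_add [intro]: "abs_summable f \<Longrightarrow> abs_summable g \<Longrightarrow> abs_summable (f + g)"
  unfolding abs_summable_def
  by (rule summable_comparison_test'[where N = 0, OF summable_add[of "\<lambda>n. norm (fps_nth f n)" "\<lambda>n. norm (fps_nth g n)"]])
    (auto intro: norm_triangle_ineq)

lemma abs_summable_uminus [intro]: "abs_summable f \<Longrightarrow> abs_summable (- f)"
  by (simp add: abs_summable_def)

lemma abs_summable_diff [intro]: "abs_summable f \<Longrightarrow> abs_summable g \<Longrightarrow> abs_summable (f - g)"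
  using abs_summable_add[of f "- g"] by auto

lemma abs_summable_mult [intro]:
  assumes "abs_summable f" "abs_summable g"
  shows "abs_summable (f * g)"
  unfolding abs_summable_def
proof (rule summable_comparison_test'[where N = 0])
  show "summable (\<lambda>n. \<Sum>i\<le>n. norm (fps_nth f i) * norm (fps_nth g (n - i)))"
    using assms by (intro summable_Cauchy_product) (auto simp: abs_summable_def)
  show "norm (norm (fps_nth (f * g) n)) \<le> (\<Sum>i\<le>n. norm (fps_nth f i) * norm (fps_nth g (n - i)))" for n
    using norm_fps_mult_nth_le[of f g n] by simp
qed

lemma abs_summable_finite:
  assumes "\<And>n. n > N \<Longrightarrow> fps_nth f n = 0"
  shows "abs_summable f"
  unfolding abs_summable_def
  by (rule summable_finite[of "{..N}"]) (use assms in auto)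

lemma abs_summable_simps [simp]:
  "abs_summable (fps_const c)" "abs_summable 1" "abs_summable fps_X" "abs_summable (numeral m)"
  by (rule abs_summable_finite[of 1]; simp add: numeral_fps_const)+

lemma abs_summable_power [intro]: "abs_summable f \<Longrightarrow> abs_summable (f ^ n)"
  by (induction n) auto

lemma fps_ev_add: "abs_summable f \<Longrightarrow> abs_summable g \<Longrightarrow> fps_ev (f + g) = fps_ev f + fps_ev g"
  by (simp add: fps_ev_def suminf_add abs_summable_imp_summable)

lemma fps_ev_diff: "abs_summable f \<Longrightarrow> abs_summable g \<Longrightarrow> fps_ev (f - g) = fps_ev f - fps_ev g"
  by (simp add: fps_ev_def suminf_diff abs_summable_imp_summable)

lemma fps_ev_mult: "abs_summable f \<Longrightarrow> abs_summable g \<Longrightarrow> fps_ev (f * g) = fps_ev f * fps_ev g"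
  by (simp add: fps_ev_def fps_mult_nth atLeast0AtMost Cauchy_product abs_summable_def)

lemma fps_ev_const [simp]: "fps_ev (fps_const c) = c"
  unfolding fps_ev_def by (subst suminf_finite[of "{0}"]) auto

lemma fps_ev_1 [simp]: "fps_ev 1 = 1"
  using fps_ev_const[of 1] by simp

lemma fps_ev_X [simp]: "fps_ev fps_X = 1"
  unfolding fps_ev_def by (subst suminf_finite[of "{1}"]) auto

lemma fps_ev_power: "abs_summable f \<Longrightarrow> fps_ev (f ^ n) = fps_ev f ^ n"
  by (induction n) (simp_all add: fps_ev_mult abs_summable_power)

section \<open>Families of power series near \<open>u = 1\<close>\<close>

text \<open>One constant and one neighbourhood serve all \<open>n\<close>. The filter
  \<open>nhds 1\<close> includes the point 1 itself, where the positivity arguments take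
  place.\<close>

definition unif_O :: "(complex \<Rightarrow> complex fps) \<Rightarrow> (nat \<Rightarrow> real) \<Rightarrow> bool" where
  "unif_O f w \<longleftrightarrow> (\<exists>C. \<forall>\<^sub>F u in nhds 1. \<forall>n. norm (fps_nth (f u) n) \<le> C * w n)"

definition loc_bdd :: "(complex \<Rightarrow> complex) \<Rightarrow> bool" where
  "loc_bdd c \<longleftrightarrow> (\<exists>C. \<forall>\<^sub>F u in nhds 1. norm (c u) \<le> C)"

lemma eventually_norm_less_isCont:
  assumes "isCont c (1 :: complex)" "norm (c 1) < C"
  shows "\<forall>\<^sub>F u in nhds 1. norm (c u) < C"
proof -
  have "((\<lambda>u. norm (c u)) \<longlongrightarrow> norm (c 1)) (at 1)"
    using assms(1) by (intro tendsto_norm) (simp add: isCont_def)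
  then have "\<forall>\<^sub>F u in at 1. norm (c u) < C"
    using assms(2) by (rule order_tendstoD)
  then show ?thesis
    using assms(2) by (auto simp: eventually_nhds_conv_at)
qed

lemma isCont_imp_loc_bdd: "isCont c 1 \<Longrightarrow> loc_bdd c"
  unfolding loc_bdd_def using eventually_norm_less_isCont[of c "norm (c 1) + 1"]
  by (auto elim: eventually_mono intro!: exI[of _ "norm (c 1) + 1"])

lemma loc_bdd_mult: 
  assumes "loc_bdd c" "loc_bdd d"
  shows "loc_bdd (\<lambda>u. c u * d u)"
proof -
  from assms obtain C D where "\<forall>\<^sub>F u in nhds 1. norm (c u) \<le> C" "\<forall>\<^sub>F u in nhds 1. norm (d u) \<le> D"
    by (auto simp: loc_bdd_def)
  then have "\<forall>\<^sub>F u in nhds 1. norm (c u * d u) \<le> C * D"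
  proof eventually_elim
    case (elim u)
    then show ?case unfolding norm_mult
      by (intro mult_mono) (auto intro: order_trans[OF norm_ge_zero])
  qed
  then show ?thesis unfolding loc_bdd_def by blast
qed

lemma unif_O_cong:
  assumes "unif_O f w" "\<forall>\<^sub>F u in nhds 1. f u = g u"
  shows "unif_O g w"
proof -
  from assms(1) obtain C where "\<forall>\<^sub>F u in nhds 1. \<forall>n. norm (fps_nth (f u) n) \<le> C * w n"
    by (auto simp: unif_O_def)
  with assms(2) have "\<forall>\<^sub>F u in nhds 1. \<forall>n. norm (fps_nth (g u) n) \<le> C * w n"
    by eventually_elim simp
  then show ?thesis unfolding unif_O_def by blast
qed

lemma unif_O_nonnegE:
  assumes "unif_O f w" "\<And>n. w n \<ge> 0"
  obtains C where "C \<ge> 0" "\<forall>\<^sub>F u in nhds 1. \<forall>n. norm (fps_nth (f u) n) \<le> C * w n"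
proof -
  from assms obtain C where C: "\<forall>\<^sub>F u in nhds 1. \<forall>n. norm (fps_nth (f u) n) \<le> C * w n"
    by (auto simp: unif_O_def)
  then have "\<forall>\<^sub>F u in nhds 1. \<forall>n. norm (fps_nth (f u) n) \<le> max C 0 * w n"
  proof eventually_elim
    case (elim u)
    have "C * w n \<le> max C 0 * w n" for n by (intro mult_right_mono assms) simp
    with elim show ?case by (meson order_trans)
  qed
  then show ?thesis by (intro that[of "max C 0"]) auto
qed

lemma unif_O_mono:
  assumes "unif_O f w" "\<And>n. 0 \<le> w n" "\<And>n. w n \<le> w' n"
  shows "unif_O f w'"
proof -
  from assms obtain C where C: "C \<ge> 0" "\<forall>\<^sub>F u in nhds 1. \<forall>n. norm (fps_nth (f u) n) \<le> C * w n"
    by (auto elim!: unif_O_nonnegE)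
  from C(2) have "\<forall>\<^sub>F u in nhds 1. \<forall>n. norm (fps_nth (f u) n) \<le> C * w' n"
    by eventually_elim (meson C(1) assms(3) mult_left_mono order_trans)
  then show ?thesis unfolding unif_O_def by blast
qed

lemma unif_O_add:
  assumes "unif_O f w" "unif_O g w"
  shows "unif_O (\<lambda>u. f u + g u) w"
proof -
  from assms obtain C D where "\<forall>\<^sub>F u in nhds 1. \<forall>n. norm (fps_nth (f u) n) \<le> C * w n"
    "\<forall>\<^sub>F u in nhds 1. \<forall>n. norm (fps_nth (g u) n) \<le> D * w n"
    by (auto simp: unif_O_def)
  then have "\<forall>\<^sub>F u in nhds 1. \<forall>n. norm (fps_nth (f u + g u) n) \<le> (C + D) * w n"
  proof eventually_elim
    case (elim u)
    show ?case
    proof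
      fix n
      show "norm (fps_nth (f u + g u) n) \<le> (C + D) * w n"
        using norm_triangle_ineq[of "fps_nth (f u) n" "fps_nth (g u) n"] elim[THEN spec, of n]
        by (simp add: distrib_right)
    qed
  qed
  then show ?thesis unfolding unif_O_def by blast
qed

lemma unif_O_uminus: "unif_O f w \<Longrightarrow> unif_O (\<lambda>u. - f u) w"
  by (simp add: unif_O_def)

lemma unif_O_diff: "unif_O f w \<Longrightarrow> unif_O g w \<Longrightarrow> unif_O (\<lambda>u. f u - g u) w"
  using unif_O_add[OF _ unif_O_uminus, of f w g] by simp

text \<open>Two weights, so that one proof covers both products inside the algebra and its action on
  series with O(1/n) coefficients.\<close>

lemma unif_O_mult_gen:
  assumes conv: "\<And>n. (\<Sum>i\<le>n. v i * w (n - i)) \<le> B * v n"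
    and v: "\<And>n. v n \<ge> 0" and w: "\<And>n. w n \<ge> 0"
    and f: "unif_O f v" and g: "unif_O g w"
  shows "unif_O (\<lambda>u. f u * g u) v"
proof -
  obtain C where C: "C \<ge> 0" "\<forall>\<^sub>F u in nhds 1. \<forall>n. norm (fps_nth (f u) n) \<le> C * v n"
    by (rule unif_O_nonnegE[OF f v])
  obtain D where D: "D \<ge> 0" "\<forall>\<^sub>F u in nhds 1. \<forall>n. norm (fps_nth (g u) n) \<le> D * w n"
    by (rule unif_O_nonnegE[OF g w])
  from C(2) D(2) have "\<forall>\<^sub>F u in nhds 1. \<forall>n. norm (fps_nth (f u * g u) n) \<le> (C * D * B) * v n"
  proof eventually_elim
    case (elim u)
    show ?case
    proof
      fix n
      have "norm (fps_nth (f u * g u) n) \<le> (\<Sum>i\<le>n. norm (fps_nth (f u) i) * norm (fps_nth (g u) (n - i)))"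
        by (rule norm_fps_mult_nth_le)
      also have "\<dots> \<le> (\<Sum>i\<le>n. (C * v i) * (D * w (n - i)))"
        using elim C D v w by (intro sum_mono mult_mono) auto
      also have "\<dots> = C * D * (\<Sum>i\<le>n. v i * w (n - i))"
        unfolding sum_distrib_left by (simp only: mult_ac)
      also have "\<dots> \<le> C * D * (B * v n)"
        using C D by (intro mult_left_mono conv) auto
      finally show "norm (fps_nth (f u * g u) n) \<le> (C * D * B) * v n" by simp
    qed
  qed
  then show ?thesis unfolding unif_O_def by blast
qed

abbreviation rsq2 :: "nat \<Rightarrow> real" where "rsq2 \<equiv> (\<lambda>n. rsq n ^ 2)"
abbreviation rsq3 :: "nat \<Rightarrow> real" where "rsq3 \<equiv> (\<lambda>n. rsq n ^ 3)"

lemma unif_O_mult: "unif_O f rsq3 \<Longrightarrow> unif_O g rsq3 \<Longrightarrow> unif_O (\<lambda>u. f u * g u) rsq3"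
  by (rule unif_O_mult_gen[OF conv_cube_cube]) auto

lemma unif_O_mult_rsq2: "unif_O f rsq2 \<Longrightarrow> unif_O g rsq3 \<Longrightarrow> unif_O (\<lambda>u. f u * g u) rsq2"
  by (rule unif_O_mult_gen[OF conv_sq_cube]) auto

lemma unif_O_rsq3_imp_rsq2: "unif_O f rsq3 \<Longrightarrow> unif_O f rsq2"
  by (erule unif_O_mono) (auto intro!: power_decreasing rsq_le_1)

lemma unif_O_const:
  assumes "loc_bdd c"
  shows "unif_O (\<lambda>u. fps_const (c u)) rsq3"
proof -
  from assms obtain C where "\<forall>\<^sub>F u in nhds 1. norm (c u) \<le> C" by (auto simp: loc_bdd_def)
  then have "\<forall>\<^sub>F u in nhds 1. \<forall>n. norm (fps_nth (fps_const (c u)) n) \<le> C * rsq n ^ 3"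
  proof eventually_elim
    case (elim u)
    then have "0 \<le> C" by (rule order_trans[rotated]) simp
    with elim show ?case by (auto simp: rsq_def)
  qed
  then show ?thesis unfolding unif_O_def by blast
qed

lemma unif_O_1: "unif_O (\<lambda>u. 1) rsq3"
  using unif_O_const[of "\<lambda>u. 1"] by (simp add: isCont_imp_loc_bdd)

lemma unif_O_X: "unif_O (\<lambda>u. fps_X) rsq3"
proof -
  \<comment> \<open>The constant is \<open>1 / rsq 1 ^ 3\<close>.\<close>
  have "norm (fps_nth (fps_X :: complex fps) n) \<le> sqrt 2 ^ 3 * rsq n ^ 3" for n
    by (cases "n = 1") (auto simp: rsq_def power_divide)
  then show ?thesis unfolding unif_O_def by (intro exI[of _ "sqrt 2 ^ 3"]) auto
qed

lemmas unif_O_intros = unif_O_mult unif_O_add unif_O_diff unif_O_const unif_O_1 unif_O_X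

lemma abs_summable_bound:
  assumes "\<And>n. norm (fps_nth f n) \<le> C * rsq n ^ 3"
  shows "abs_summable f"
  unfolding abs_summable_def
  by (rule summable_comparison_test'[where N = 0, OF summable_mult[OF summable_rsq_cube, of C]])
    (use assms in auto)

lemma unif_O_abs_summable:
  assumes "unif_O f rsq3"
  shows "\<forall>\<^sub>F u in nhds 1. abs_summable (f u)"
proof -
  from assms obtain C where "\<forall>\<^sub>F u in nhds 1. \<forall>n. norm (fps_nth (f u) n) \<le> C * rsq n ^ 3"
    by (auto simp: unif_O_def)
  then show ?thesis by eventually_elim (auto intro: abs_summable_bound)
qed

text \<open>Tannery's theorem with the majorant \<open>C * rsq n ^ 3\<close>. Continuity of the norm
  sum later carries a strict bound at \<open>u = 1\<close> to a neighbourhood.\<close>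

lemma
  assumes "unif_O f rsq3" "\<And>n. isCont (\<lambda>u. fps_nth (f u) n) 1"
  shows isCont_fps_ev: "isCont (\<lambda>u. fps_ev (f u)) 1"
    and isCont_suminf_norm: "isCont (\<lambda>u. \<Sum>n. norm (fps_nth (f u) n)) 1"
proof -
  from assms obtain C where C: "\<forall>\<^sub>F u in nhds 1. \<forall>n. norm (fps_nth (f u) n) \<le> C * rsq n ^ 3"
    by (auto simp: unif_O_def)
  then have C': "\<forall>\<^sub>F u in at 1. \<forall>n. norm (fps_nth (f u) n) \<le> C * rsq n ^ 3"
    by (simp add: eventually_nhds_conv_at)
  have ev: "\<forall>\<^sub>F (n, u) in sequentially \<times>\<^sub>F at 1. norm (fps_nth (f u) n) \<le> C * rsq n ^ 3"
    unfolding eventually_prod_filter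
    by (intro exI[of _ "\<lambda>_. True"] exI[of _ "\<lambda>u. \<forall>n. norm (fps_nth (f u) n) \<le> C * rsq n ^ 3"])
      (use C' in auto)
  have lim: "((\<lambda>u. fps_nth (f u) n) \<longlongrightarrow> fps_nth (f 1) n) (at 1)" for n
    using assms(2)[of n] by (simp add: isCont_def)
  have sm: "summable (\<lambda>n. C * rsq n ^ 3)"
    by (intro summable_mult summable_rsq_cube)
  have "((\<lambda>u. \<Sum>n. fps_nth (f u) n) \<longlongrightarrow> (\<Sum>n. fps_nth (f 1) n)) (at 1)"
    using tannerys_theorem[of "\<lambda>n u. fps_nth (f u) n" "\<lambda>n. fps_nth (f 1) n" "at 1"
        "\<lambda>n. C * rsq n ^ 3", OF lim ev sm] by simp
  then show "isCont (\<lambda>u. fps_ev (f u)) 1"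
    by (simp add: isCont_def fps_ev_def)
  have ev': "\<forall>\<^sub>F (n, u) in sequentially \<times>\<^sub>F at 1. norm (norm (fps_nth (f u) n)) \<le> C * rsq n ^ 3"
    using ev by simp
  have "((\<lambda>u. \<Sum>n. norm (fps_nth (f u) n)) \<longlongrightarrow> (\<Sum>n. norm (fps_nth (f 1) n))) (at 1)"
    using tannerys_theorem[of "\<lambda>n u. norm (fps_nth (f u) n)" "\<lambda>n. norm (fps_nth (f 1) n)" "at 1"
        "\<lambda>n. C * rsq n ^ 3", OF tendsto_norm[OF lim] ev' sm] by simp
  then show "isCont (\<lambda>u. \<Sum>n. norm (fps_nth (f u) n)) 1"
    by (simp add: isCont_def)
qed

lemma unif_O_isqrt_compose:
  assumes h: "unif_O h rsq3"
    and \<gamma>: "\<forall>\<^sub>F u in nhds 1. \<forall>N. (\<Sum>i\<le>N. norm (fps_nth (h u) i)) \<le> \<gamma>" "\<gamma> < 1"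
  shows "unif_O (\<lambda>u. isqrt_fps oo h u) rsq3"
proof -
  from h obtain K where K: "\<forall>\<^sub>F u in nhds 1. \<forall>n. norm (fps_nth (h u) n) \<le> K * rsq n ^ 3"
    by (auto simp: unif_O_def)
  from eventually_nhds_x_imp_x[OF \<gamma>(1)] have "norm (fps_nth (h 1) 0) \<le> \<gamma>"
    by (auto dest: spec[of _ 0])
  then have "0 \<le> \<gamma>" by (rule order_trans[rotated]) simp
  then obtain D where D: "\<And>h K n. (\<And>n. norm (fps_nth h n) \<le> K * rsq n ^ 3) \<Longrightarrow>
      (\<And>N. (\<Sum>i\<le>N. norm (fps_nth h i)) \<le> \<gamma>) \<Longrightarrow>
      norm (fps_nth (isqrt_fps oo h) n) \<le> (1 + K * D) * rsq n ^ 3"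
    using \<gamma>(2) by (rule isqrt_fps_compose_bound) blast
  from K \<gamma>(1) have "\<forall>\<^sub>F u in nhds 1. \<forall>n. norm (fps_nth (isqrt_fps oo h u) n) \<le> (1 + K * D) * rsq n ^ 3"
    by eventually_elim (auto intro!: D)
  then show ?thesis unfolding unif_O_def by blast
qed

section \<open>Effect of multiplication on the leading n^(-1/2) term\<close>

definition rsq_fps :: "complex fps" where
  "rsq_fps = Abs_fps (\<lambda>n. of_real (rsq n))"

text \<open>Replacing \<open>rsq (n - i)\<close> by \<open>rsq n\<close> in the convolution costs 4
  by \<open>rsq_cube_diff_le\<close> and \<open>conv_rsq_rsq\<close>; completing the partial sum of
  \<open>q\<close> to \<open>fps_ev q\<close> costs the tail, which contributes 2.\<close>

lemma norm_rsq_fps_mult_le: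
  assumes q: "\<And>n. norm (fps_nth q n) \<le> C * rsq n ^ 3"
  shows "norm (fps_nth (rsq_fps * q - fps_const (fps_ev q) * rsq_fps) n) \<le> (6 * C) * rsq n ^ 2"
proof -
  have "0 \<le> norm (fps_nth q 0)" by simp
  also have "norm (fps_nth q 0) \<le> C" using q[of 0] by (simp add: rsq_def)
  finally have C0: "0 \<le> C" .
  have abs: "abs_summable q" by (rule abs_summable_bound[OF q])
  then have abs': "summable (\<lambda>i. norm (fps_nth q (i + Suc n)))"
    by (simp only: abs_summable_def summable_iff_shift[of "\<lambda>i. norm (fps_nth q i)"])
  define t where "t = (\<Sum>i. fps_nth q (i + Suc n))"
  have t: "norm t \<le> C * (2 * rsq n)"
  proof -
    have "norm t \<le> (\<Sum>i. norm (fps_nth q (i + Suc n)))"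
      unfolding t_def by (rule summable_norm[OF abs'])
    also have "\<dots> \<le> (\<Sum>i. C * rsq (i + Suc n) ^ 3)"
      using summable_rsq_cube by (intro suminf_le q abs' summable_mult) (simp only: summable_iff_shift[of "\<lambda>i. rsq i ^ 3"])
    also have "\<dots> = C * (\<Sum>i. rsq (i + Suc n) ^ 3)"
      using summable_rsq_cube by (intro suminf_mult) (simp only: summable_iff_shift[of "\<lambda>i. rsq i ^ 3"])
    also have "\<dots> \<le> C * (2 * rsq n)"
      by (intro mult_left_mono rsq_cube_tail_le C0)
    finally show ?thesis .
  qed
  have ev: "fps_ev q = t + (\<Sum>i\<le>n. fps_nth q i)"
    unfolding fps_ev_def t_def using suminf_split_initial_segment[OF abs_summable_imp_summable[OF abs], of "Suc n"]
    by (simp add: lessThan_Suc_atMost)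
  have "fps_nth (rsq_fps * q) n = (\<Sum>i\<le>n. fps_nth q i * of_real (rsq (n - i)))"
    by (subst mult.commute) (simp add: fps_mult_nth rsq_fps_def atLeast0AtMost)
  then have "fps_nth (rsq_fps * q - fps_const (fps_ev q) * rsq_fps) n =
      (\<Sum>i\<le>n. fps_nth q i * of_real (rsq (n - i) - rsq n)) - t * of_real (rsq n)"
    by (simp add: ev rsq_fps_def algebra_simps sum_subtractf sum_distrib_left)
  also have "norm \<dots> \<le> norm (\<Sum>i\<le>n. fps_nth q i * of_real (rsq (n - i) - rsq n)) + norm (t * of_real (rsq n))"
    by (rule norm_triangle_ineq4)
  also have "norm (\<Sum>i\<le>n. fps_nth q i * of_real (rsq (n - i) - rsq n)) \<le>
      (\<Sum>i\<le>n. C * (rsq n ^ 2 * (rsq i * rsq (n - i))))"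
  proof (rule sum_norm_le)
    fix i assume i: "i \<in> {..n}"
    have "rsq (n - i) - rsq n \<ge> 0" by (simp add: rsq_mono)
    then have "norm (fps_nth q i * of_real (rsq (n - i) - rsq n)) = norm (fps_nth q i) * (rsq (n - i) - rsq n)"
      by (simp only: norm_mult norm_of_real abs_of_nonneg)
    also have "\<dots> \<le> C * rsq i ^ 3 * (rsq (n - i) - rsq n)"
      by (intro mult_right_mono q) (simp add: rsq_mono)
    also have "\<dots> = C * (rsq i ^ 3 * (rsq (n - i) - rsq n))" by simp
    also have "\<dots> \<le> C * (rsq n ^ 2 * (rsq i * rsq (n - i)))"
      using i by (intro mult_left_mono rsq_cube_diff_le C0) auto
    finally show "norm (fps_nth q i * of_real (rsq (n - i) - rsq n)) \<le> C * (rsq n ^ 2 * (rsq i * rsq (n - i)))" .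
  qed
  also have "\<dots> = C * (rsq n ^ 2 * (\<Sum>i\<le>n. rsq i * rsq (n - i)))"
    by (simp only: sum_distrib_left)
  also have "\<dots> \<le> C * (rsq n ^ 2 * 4)"
    by (intro mult_left_mono conv_rsq_rsq C0) simp
  also have "norm (t * of_real (rsq n)) \<le> C * (2 * rsq n) * rsq n"
    unfolding norm_mult by (intro mult_mono t) (auto simp: C0)
  finally show ?thesis by (simp add: power2_eq_square algebra_simps)
qed

definition rsq_asymp :: "(complex \<Rightarrow> complex) \<Rightarrow> (complex \<Rightarrow> complex fps) \<Rightarrow> bool" where
  "rsq_asymp \<kappa> f \<longleftrightarrow> unif_O (\<lambda>u. f u - fps_const (\<kappa> u) * rsq_fps) rsq2"

lemma loc_bdd_fps_ev:
  assumes "unif_O q rsq3"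
  shows "loc_bdd (\<lambda>u. fps_ev (q u))"
proof -
  from assms obtain C where "\<forall>\<^sub>F u in nhds 1. \<forall>n. norm (fps_nth (q u) n) \<le> C * rsq n ^ 3"
    by (auto simp: unif_O_def)
  then have "\<forall>\<^sub>F u in nhds 1. norm (fps_ev (q u)) \<le> (\<Sum>n. C * rsq n ^ 3)"
  proof eventually_elim
    case (elim u)
    then have s: "summable (\<lambda>n. norm (fps_nth (q u) n))"
      using abs_summable_bound unfolding abs_summable_def by blast
    have "norm (fps_ev (q u)) \<le> (\<Sum>n. norm (fps_nth (q u) n))"
      unfolding fps_ev_def by (rule summable_norm[OF s])
    also have "\<dots> \<le> (\<Sum>n. C * rsq n ^ 3)"
      using elim by (intro suminf_le s summable_mult summable_rsq_cube) auto
    finally show ?case .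
  qed
  then show ?thesis unfolding loc_bdd_def by blast
qed

text \<open>The error splits into (f - \<kappa> r) q, handled by the module property, and \<kappa>
  (r q - q(1) r), handled by \<open>norm_rsq_fps_mult_le\<close>, where r is
  \<open>rsq_fps\<close>.\<close>

lemma rsq_asymp_mult:
  assumes f: "rsq_asymp \<kappa> f" and q: "unif_O q rsq3" and \<kappa>: "loc_bdd \<kappa>"
  shows "rsq_asymp (\<lambda>u. \<kappa> u * fps_ev (q u)) (\<lambda>u. f u * q u)"
proof -
  have "unif_O (\<lambda>u. rsq_fps * q u - fps_const (fps_ev (q u)) * rsq_fps) rsq2"
  proof -
    from q obtain C where "\<forall>\<^sub>F u in nhds 1. \<forall>n. norm (fps_nth (q u) n) \<le> C * rsq n ^ 3"
      by (auto simp: unif_O_def)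
    then have "\<forall>\<^sub>F u in nhds 1. \<forall>n. norm (fps_nth (rsq_fps * q u - fps_const (fps_ev (q u)) * rsq_fps) n)
        \<le> (6 * C) * rsq n ^ 2"
      by eventually_elim (intro allI norm_rsq_fps_mult_le, blast)
    then show ?thesis unfolding unif_O_def by blast
  qed
  from unif_O_mult_rsq2[OF this unif_O_const[OF \<kappa>]] unif_O_mult_rsq2[OF f[unfolded rsq_asymp_def] q]
  have "unif_O (\<lambda>u. (rsq_fps * q u - fps_const (fps_ev (q u)) * rsq_fps) * fps_const (\<kappa> u) +
      (f u - fps_const (\<kappa> u) * rsq_fps) * q u) rsq2"
    by (rule unif_O_add)
  then show ?thesis
    unfolding rsq_asymp_def fps_const_mult[symmetric] by (simp add: algebra_simps)
qed

lemma rsq_asymp_add: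
  assumes "rsq_asymp \<kappa> f" "unif_O g rsq2"
  shows "rsq_asymp \<kappa> (\<lambda>u. f u + g u)"
  using unif_O_add[OF assms(1)[unfolded rsq_asymp_def] assms(2)] by (simp add: rsq_asymp_def algebra_simps)

lemma rsq_asymp_cong:
  assumes "rsq_asymp \<kappa> f" "\<forall>\<^sub>F u in nhds 1. \<kappa> u = \<kappa>' u \<and> f u = f' u"
  shows "rsq_asymp \<kappa>' f'"
  unfolding rsq_asymp_def by (rule unif_O_cong[OF assms(1)[unfolded rsq_asymp_def]]) (use assms(2) in \<open>auto elim: eventually_mono\<close>)

text \<open>Dividing the coefficients of \<open>fps_X * fps_deriv (f u)\<close> by \<open>n\<close>
  gains one power and puts \<open>f\<close> back into the algebra. The derivative does not see the
  constant coefficient, hence the last hypothesis.\<close>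

lemma rsq_asymp_deriv_imp_unif_O:
  assumes f: "rsq_asymp \<kappa> (\<lambda>u. fps_X * fps_deriv (f u))" and \<kappa>: "loc_bdd \<kappa>" and 0: "\<And>u. fps_nth (f u) 0 = 0"
  shows "unif_O f rsq3"
proof -
  obtain C where C: "C \<ge> 0" "\<forall>\<^sub>F u in nhds 1. \<forall>n. norm (fps_nth (fps_X * fps_deriv (f u) - fps_const (\<kappa> u) * rsq_fps) n) \<le> C * rsq n ^ 2"
    using f unfolding rsq_asymp_def by (rule unif_O_nonnegE) auto
  from \<kappa> obtain D where D: "\<forall>\<^sub>F u in nhds 1. norm (\<kappa> u) \<le> D" by (auto simp: loc_bdd_def)
  from C(2) D have "\<forall>\<^sub>F u in nhds 1. \<forall>n. norm (fps_nth (f u) n) \<le> (2 * (C + D)) * rsq n ^ 3"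
  proof eventually_elim
    case (elim u)
    then have D0: "0 \<le> D" by (meson norm_ge_zero order_trans)
    show ?case
    proof
      fix n
      show "norm (fps_nth (f u) n) \<le> (2 * (C + D)) * rsq n ^ 3"
      proof (cases "n = 0")
        case False
        have "norm (of_nat n * fps_nth (f u) n - \<kappa> u * of_real (rsq n)) \<le> C * rsq n ^ 2"
          using elim(1)[THEN spec, of n] False by (cases n) (auto simp: rsq_fps_def)
        then have "norm (of_nat n * fps_nth (f u) n) \<le> C * rsq n ^ 2 + norm (\<kappa> u * of_real (rsq n))"
          by (meson norm_triangle_sub order_trans add_left_mono add_mono_thms_linordered_semiring(3) diff_le_eq norm_triangle_ineq2)
        also have "norm (\<kappa> u * of_real (rsq n)) \<le> D * rsq n"
          using elim(2) by (simp add: norm_mult mult_right_mono)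
        also have "C * rsq n ^ 2 \<le> C * rsq n"
          using rsq_le_1[of n] C(1) by (intro mult_left_mono) (auto simp: power2_eq_square mult_left_le)
        finally have le: "real n * norm (fps_nth (f u) n) \<le> (C + D) * rsq n"
          by (simp add: norm_mult distrib_right)
        have "norm (fps_nth (f u) n) = rsq n ^ 2 * ((real n + 1) * norm (fps_nth (f u) n))"
          by (simp add: rsq_power2 add_pos_nonneg[THEN less_imp_neq, THEN not_sym])
        \<comment> \<open>The factor 2 comes from \<open>n + 1 \<le> 2 * n\<close> for positive
          \<open>n\<close>.\<close>
        also have "\<dots> \<le> rsq n ^ 2 * (2 * (real n * norm (fps_nth (f u) n)))"
          using False mult_right_mono[of 1 "real n" "norm (fps_nth (f u) n)"]
          by (intro mult_left_mono) (auto simp: distrib_right)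
        also have "\<dots> \<le> rsq n ^ 2 * (2 * ((C + D) * rsq n))"
          by (intro mult_left_mono le) auto
        finally show ?thesis by (simp add: power2_eq_square power3_eq_cube mult_ac)
      qed (use 0 C(1) D0 in auto)
    qed
  qed
  then show ?thesis unfolding unif_O_def by blast
qed

lemma isCont_Re_pos:
  assumes "isCont f (1 :: complex)" "Re (f 1) > 0"
  shows "\<forall>\<^sub>F u in nhds 1. Re (f u) > 0"
proof -
  have "((\<lambda>u. Re (f u)) \<longlongrightarrow> Re (f 1)) (at 1)"
    using assms(1) by (intro tendsto_Re) (simp add: isCont_def)
  then have "\<forall>\<^sub>F u in at 1. Re (f u) > 0"
    using assms(2) by (rule order_tendstoD)
  then show ?thesis
    using assms(2) by (auto simp: eventually_nhds_conv_at)
qed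

text \<open>Fixes the sign left open when a square root is identified by its square.\<close>

lemma eq_if_power2_eq_Re_pos:
  assumes "(a :: complex) ^ 2 = b ^ 2" "Re a > 0" "Re b > 0"
  shows "a = b"
  using assms by (auto simp: power2_eq_iff)

section \<open>Terms with free variables\<close>

definition open_lterms :: "nat \<Rightarrow> nat \<Rightarrow> nat \<Rightarrow> lterm set" where
  "open_lterms k L n = {t. closed_under L t \<and> (\<forall>i\<in>indices t. i \<le> k) \<and> nodes t = n}"

definition open_gf :: "nat \<Rightarrow> complex \<Rightarrow> nat \<Rightarrow> complex fps" where
  "open_gf k u L = Abs_fps (\<lambda>n. \<Sum>t\<in>open_lterms k L n. u ^ leaves t)"

lemma G_series_eq_open_gf: "G_series k u = open_gf k u 0"
  by (simp add: G_series_def open_gf_def closed_lterms_def open_lterms_def conj_assoc)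

lemma nodes_pos: "nodes t > 0"
  by (cases t) auto

lemma open_lterms_0: "open_lterms k L 0 = {}"
  using nodes_pos by (auto simp: open_lterms_def)

lemma open_lterms_Suc:
  "open_lterms k L (Suc n) = (if n = 0 then Var ` {1..min L k} else {}) \<union> Abs ` open_lterms k (Suc L) n \<union>
     (\<lambda>(s, t). App s t) ` (\<Union>i\<le>n. open_lterms k L i \<times> open_lterms k L (n - i))" (is "_ = ?R")
proof (intro equalityI subsetI)
  fix t assume "t \<in> open_lterms k L (Suc n)"
  then show "t \<in> ?R"
    using nodes_pos by (cases t) (force simp: open_lterms_def image_iff)+
next
  fix t assume "t \<in> ?R"
  then show "t \<in> open_lterms k L (Suc n)"
    by (auto simp: open_lterms_def split: if_splits)
qed

lemma finite_open_lterms: "finite (open_lterms k L n)"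
\<comment> \<open>\<open>L\<close> is generalised because passing below an abstraction lowers the
  size but raises \<open>L\<close>.\<close>
proof (induction n arbitrary: L rule: less_induct)
  case (less n)
  show ?case
  proof (cases n)
    case (Suc m)
    have "finite (\<Union>i\<le>m. open_lterms k L i \<times> open_lterms k L (m - i))"
      using less Suc by (intro finite_UN_I finite_cartesian_product) auto
    then show ?thesis
      using less[of m "Suc L"] by (simp add: Suc open_lterms_Suc)
  qed (simp add: open_lterms_0)
qed

text \<open>Beyond \<open>k\<close> binders the bound on the indices is the stronger condition. This
  closes the chain of recursions at \<open>L = k\<close>.\<close>

lemma open_lterms_saturated:
  assumes "k \<le> L"
  shows "open_lterms k (Suc L) n = open_lterms k L n"
proof -
  have "closed_under (Suc L) t \<longleftrightarrow> closed_under L t" if "\<forall>i\<in>indices t. i \<le> k" for t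
    using that assms by (induction t arbitrary: L) (auto simp: ball_Un)
  then show ?thesis by (auto simp: open_lterms_def)
qed

lemma sum_open_lterms_Suc:
  fixes u :: complex
  shows "(\<Sum>t\<in>open_lterms k L (Suc n). u ^ leaves t) =
     (if n = 0 then of_nat (min L k) * u else 0) + (\<Sum>t\<in>open_lterms k (Suc L) n. u ^ leaves t) +
     (\<Sum>i\<le>n. (\<Sum>t\<in>open_lterms k L i. u ^ leaves t) * (\<Sum>t\<in>open_lterms k L (n - i). u ^ leaves t))"
proof -
  define A where "A = (if n = 0 then Var ` {1..min L k} else {})"
  define B where "B = Abs ` open_lterms k (Suc L) n"
  define P where "P = (\<Union>i\<le>n. open_lterms k L i \<times> open_lterms k L (n - i))"
  have fin: "finite A" "finite B" "finite P"
    by (auto simp: A_def B_def P_def finite_open_lterms)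
  have A: "(\<Sum>t\<in>A. u ^ leaves t) = (if n = 0 then of_nat (min L k) * u else 0)"
    by (simp add: A_def sum.reindex inj_on_def)
  have B: "(\<Sum>t\<in>B. u ^ leaves t) = (\<Sum>t\<in>open_lterms k (Suc L) n. u ^ leaves t)"
    by (simp add: B_def sum.reindex inj_on_def)
  have "(\<Sum>t\<in>(\<lambda>(s, t). App s t) ` P. u ^ leaves t) = (\<Sum>(s, t)\<in>P. u ^ leaves s * u ^ leaves t)"
    by (subst sum.reindex) (auto simp: inj_on_def power_add intro!: sum.cong)
  also have "\<dots> = (\<Sum>i\<le>n. \<Sum>(s, t)\<in>open_lterms k L i \<times> open_lterms k L (n - i). u ^ leaves s * u ^ leaves t)"
    \<comment> \<open>The pieces are disjoint because the first component of a pair has exactly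
      \<open>i\<close> nodes.\<close>
    unfolding P_def by (rule sum.UNION_disjoint) (simp_all add: finite_open_lterms, auto simp: open_lterms_def)
  also have "\<dots> = (\<Sum>i\<le>n. (\<Sum>t\<in>open_lterms k L i. u ^ leaves t) * (\<Sum>t\<in>open_lterms k L (n - i). u ^ leaves t))"
    by (simp add: sum_product sum.cartesian_product)
  finally have P: "(\<Sum>t\<in>(\<lambda>(s, t). App s t) ` P. u ^ leaves t) = \<dots>" .
  have "open_lterms k L (Suc n) = A \<union> B \<union> (\<lambda>(s, t). App s t) ` P"
    unfolding A_def B_def P_def by (rule open_lterms_Suc)
  moreover have "A \<inter> B = {}" "(A \<union> B) \<inter> (\<lambda>(s, t). App s t) ` P = {}"
    by (auto simp: A_def B_def split: if_splits)
  ultimately show ?thesis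
    using fin by (simp add: sum.union_disjoint A B P)
qed

lemma open_gf_rec: "open_gf k u L = fps_X * (fps_const (of_nat (min L k) * u) + open_gf k u (Suc L) + open_gf k u L ^ 2)"
proof (rule fps_ext)
  fix n
  show "fps_nth (open_gf k u L) n =
    fps_nth (fps_X * (fps_const (of_nat (min L k) * u) + open_gf k u (Suc L) + open_gf k u L ^ 2)) n"
  proof (cases n)
    case (Suc m)
    have "fps_nth (open_gf k u L) (Suc m) = (if m = 0 then of_nat (min L k) * u else 0) +
        fps_nth (open_gf k u (Suc L)) m + fps_nth (open_gf k u L * open_gf k u L) m"
      by (simp only: open_gf_def fps_nth_Abs_fps sum_open_lterms_Suc fps_mult_nth atLeast0AtMost)
    then show ?thesis
      by (simp add: Suc power2_eq_square)
  qed (simp add: open_gf_def open_lterms_0)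
qed

lemma open_gf_saturated: "k \<le> L \<Longrightarrow> open_gf k u (Suc L) = open_gf k u L"
  by (simp add: open_gf_def open_lterms_saturated)

text \<open>With s the root of \<open>k u\<close>, the discriminant (1 - z)^2 - 4 k u z^2 factors as
  (1 - (1 + 2 s) z) (1 - (1 - 2 s) z); this is the zero of the first factor.\<close>

definition dom_sing :: "nat \<Rightarrow> complex \<Rightarrow> complex" where
  "dom_sing k u = 1 / (1 + 2 * csqrt (of_nat k * u))"

text \<open>
  The level \<open>i\<close> is that of \<open>R\<^sub>i\<^sub>,\<^sub>k\<close>: for \<open>i \<ge> 2\<close> the square root of \<open>R\<^sub>i\<^sub>,\<^sub>k(\<rho> z, u)\<close> is
  \<open>1 - scaled_gf k i u\<close>, and for \<open>i = 1\<close> it is \<open>1 - \<rho> z - scaled_gf k 1 u\<close>.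
\<close>

definition scaled_gf :: "nat \<Rightarrow> nat \<Rightarrow> complex \<Rightarrow> complex fps" where
  "scaled_gf k i u = fps_const (2 * dom_sing k u) * fps_X * (open_gf k u (Suc k - i) oo (fps_const (dom_sing k u) * fps_X))"

lemma fps_nth_scaled_gf_0 [simp]: "fps_nth (scaled_gf k i u) 0 = 0"
  by (simp add: scaled_gf_def mult.assoc)

lemma fps_nth_scaled_gf_Suc:
  "fps_nth (scaled_gf k i u) (Suc n) = 2 * dom_sing k u * dom_sing k u ^ n * fps_nth (open_gf k u (Suc k - i)) n"
  by (simp add: scaled_gf_def fps_compose_linear mult.assoc)

text \<open>The recursion \<open>open_gf_rec\<close> at \<rho> z, multiplied by 2 \<rho> z. The free
  level \<open>j\<close> covers both uses: \<open>j = i\<close> at the saturated level 1, and the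
  preceding level otherwise.\<close>

lemma scaled_gf_rec:
  fixes k :: nat and u :: complex
  defines "\<rho> \<equiv> dom_sing k u"
  assumes L: "L = Suc k - i" "L \<le> k" "L' = Suc k - j" "open_gf k u (Suc L) = open_gf k u L'"
  shows "scaled_gf k i u = fps_const (2 * \<rho> ^ 2 * (of_nat L * u)) * fps_X ^ 2 +
    fps_const \<rho> * fps_X * scaled_gf k j u + fps_const (1 / 2) * scaled_gf k i u ^ 2"
proof -
  define F where "F l = open_gf k u l oo (fps_const \<rho> * fps_X)" for l
  have 0: "fps_nth (fps_const \<rho> * fps_X) 0 = 0" by simp
  have "F L = fps_const \<rho> * fps_X * (fps_const (of_nat L * u) + F L' + F L ^ 2)"
    unfolding F_def using L
    by (subst open_gf_rec)
      (simp add: fps_compose_mult_distrib[OF 0] fps_compose_power[OF 0, symmetric] fps_compose_add_distrib min_absorb1)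
  then have *: "F L - fps_const \<rho> * fps_X * (fps_const (of_nat L * u) + F L' + F L ^ 2) = 0" by simp
  have p: "scaled_gf k i u = fps_const (2 * \<rho>) * fps_X * F L" "scaled_gf k j u = fps_const (2 * \<rho>) * fps_X * F L'"
    by (simp_all add: scaled_gf_def F_def L \<rho>_def)
  have c: "fps_const (2 * \<rho>) = 2 * fps_const \<rho>" 
    "fps_const (2 * \<rho> ^ 2 * (of_nat L * u)) = 2 * fps_const \<rho> ^ 2 * fps_const (of_nat L * u)"
    by (simp_all add: numeral_fps_const fps_const_power)
  have h: "2 * fps_const (1 / 2) = (1 :: complex fps)"
    by (simp add: numeral_fps_const)
  \<comment> \<open>Doubling lets \<open>2 * fps_const (1 / 2)\<close> cancel to 1, after which only
    ring arithmetic remains.\<close>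
  have "2 * (scaled_gf k i u - (fps_const (2 * \<rho> ^ 2 * (of_nat L * u)) * fps_X ^ 2 +
    fps_const \<rho> * fps_X * scaled_gf k j u + fps_const (1 / 2) * scaled_gf k i u ^ 2)) =
    2 * scaled_gf k i u - 2 * (fps_const (2 * \<rho> ^ 2 * (of_nat L * u)) * fps_X ^ 2 +
    fps_const \<rho> * fps_X * scaled_gf k j u) - (2 * fps_const (1 / 2)) * scaled_gf k i u ^ 2"
    by (simp only: algebra_simps)
  also have "\<dots> = 4 * fps_const \<rho> * fps_X * (F L - fps_const \<rho> * fps_X * (fps_const (of_nat L * u) + F L' + F L ^ 2))"
    unfolding h unfolding p c by (simp add: algebra_simps power2_eq_square)
  also have "\<dots> = 0" unfolding * by simp
  finally show ?thesis
    unfolding mult_eq_0_iff right_minus_eq by simp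
qed

section \<open>Propagation of the singularity\<close>

text \<open>Continuity coefficient by coefficient; together with \<open>unif_O\<close> it gives
  continuity of the value at z = 1.\<close>

definition coeffs_cont :: "(complex \<Rightarrow> complex fps) \<Rightarrow> bool" where
  "coeffs_cont f \<longleftrightarrow> (\<forall>n. isCont (\<lambda>u. fps_nth (f u) n) 1)"

lemma coeffs_cont_const: "isCont c 1 \<Longrightarrow> coeffs_cont (\<lambda>u. fps_const (c u))"
  unfolding coeffs_cont_def
proof
  fix n assume "isCont c 1"
  then show "isCont (\<lambda>u. fps_nth (fps_const (c u)) n) 1" by (cases n) auto
qed

lemma coeffs_cont_fixed: "coeffs_cont (\<lambda>u. f)"
  by (auto simp: coeffs_cont_def)

lemma coeffs_cont_add: "coeffs_cont f \<Longrightarrow> coeffs_cont g \<Longrightarrow> coeffs_cont (\<lambda>u. f u + g u)"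
  by (auto simp: coeffs_cont_def)

lemma coeffs_cont_mult: "coeffs_cont f \<Longrightarrow> coeffs_cont g \<Longrightarrow> coeffs_cont (\<lambda>u. f u * g u)"
  by (auto simp: coeffs_cont_def fps_mult_nth intro!: continuous_intros)

lemma coeffs_cont_power: "coeffs_cont f \<Longrightarrow> coeffs_cont (\<lambda>u. f u ^ n)"
  by (induction n) (auto intro: coeffs_cont_mult coeffs_cont_fixed)

lemma coeffs_cont_isqrt_compose: "coeffs_cont f \<Longrightarrow> coeffs_cont (\<lambda>u. isqrt_fps oo f u)"
  using coeffs_cont_power[of f]
  by (auto simp: coeffs_cont_def fps_nth_isqrt_fps_compose intro!: continuous_intros)

section \<open>Nonnegative coefficients at u = 1\<close>

definition fps_nonneg :: "complex fps \<Rightarrow> bool" where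
  "fps_nonneg f \<longleftrightarrow> (\<forall>n. fps_nth f n \<in> \<real>\<^sub>\<ge>\<^sub>0)"

lemma nonneg_Reals_sum: "(\<And>i. i \<in> A \<Longrightarrow> f i \<in> \<real>\<^sub>\<ge>\<^sub>0) \<Longrightarrow> sum f A \<in> (\<real>\<^sub>\<ge>\<^sub>0 :: complex set)"
  by (induction A rule: infinite_finite_induct) auto

lemma fps_nonneg_const: "c \<in> \<real>\<^sub>\<ge>\<^sub>0 \<Longrightarrow> fps_nonneg (fps_const c)"
  by (auto simp: fps_nonneg_def)

lemma fps_nonneg_X: "fps_nonneg fps_X"
  by (auto simp: fps_nonneg_def)

lemma fps_nonneg_1: "fps_nonneg 1"
  by (auto simp: fps_nonneg_def)

lemma fps_nonneg_add: "fps_nonneg f \<Longrightarrow> fps_nonneg g \<Longrightarrow> fps_nonneg (f + g)"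
  by (auto simp: fps_nonneg_def)

lemma fps_nonneg_mult: "fps_nonneg f \<Longrightarrow> fps_nonneg g \<Longrightarrow> fps_nonneg (f * g)"
  by (auto simp: fps_nonneg_def fps_mult_nth intro!: nonneg_Reals_sum)

lemma fps_nonneg_power: "fps_nonneg f \<Longrightarrow> fps_nonneg (f ^ n)"
  by (induction n) (auto intro: fps_nonneg_1 fps_nonneg_mult)

lemma fps_nonneg_isqrt_compose: "fps_nonneg f \<Longrightarrow> fps_nonneg (isqrt_fps oo f)"
  using fps_nonneg_power[of f]
  by (auto simp: fps_nonneg_def fps_nth_isqrt_fps_compose isqrt_coeff_pos less_imp_le intro!: nonneg_Reals_sum nonneg_Reals_mult_I)

text \<open>Turns an algebraic evaluation at z = 1 into an l1-norm, hence into the smallness needed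
  for composition.\<close>

lemma fps_nonneg_suminf_norm:
  assumes "fps_nonneg f" "abs_summable f"
  shows "(\<Sum>n. norm (fps_nth f n)) = Re (fps_ev f)"
proof -
  have "fps_nth f n = of_real (norm (fps_nth f n))" for n
    using assms(1) by (auto simp: fps_nonneg_def nonneg_Reals_def dest!: spec[of _ n])
  then have "fps_ev f = (\<Sum>n. of_real (norm (fps_nth f n)))"
    unfolding fps_ev_def by presburger
  also have "\<dots> = of_real (\<Sum>n. norm (fps_nth f n))"
    using assms(2) by (intro suminf_of_real[symmetric]) (simp add: abs_summable_def)
  finally show ?thesis by simp
qed

section \<open>Continuity and positivity of the constants at u = 1\<close>

lemma isCont_csqrt_of_nat_mult:
  assumes "k \<ge> 1"
  shows "isCont (\<lambda>u. csqrt (of_nat k * u)) 1"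
  using assms by (intro isCont_csqrt' continuous_intros) (auto simp: complex_nonpos_Reals_iff)

text \<open>The principal root has nonnegative real part, so the real part of the sum is at least
  1.\<close>

lemma one_plus_csqrt_nonzero: "1 + 2 * csqrt z \<noteq> 0"
proof
  assume "1 + 2 * csqrt z = 0"
  then have "1 + 2 * Re (csqrt z) = 0" by (simp add: complex_eq_iff del: csqrt.sel)
  then show False using csqrt_principal[of z] by linarith
qed

lemma dom_sing_nonzero: "dom_sing k u \<noteq> 0"
  by (simp add: dom_sing_def one_plus_csqrt_nonzero)

lemma dom_sing_csqrt: "dom_sing k u * (1 + 2 * csqrt (of_nat k * u)) = 1"
  by (simp add: dom_sing_def one_plus_csqrt_nonzero)

lemma isCont_dom_sing: "k \<ge> 1 \<Longrightarrow> isCont (dom_sing k) 1"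
  unfolding dom_sing_def by (intro continuous_intros isCont_csqrt_of_nat_mult one_plus_csqrt_nonzero)

lemma dom_sing_1: "dom_sing k 1 = of_real (1 / (1 + 2 * sqrt (real k)))"
proof -
  have "csqrt (of_nat k) = of_real (sqrt (real k))"
    using of_real_sqrt[of "real k"] by simp
  then show ?thesis by (simp add: dom_sing_def)
qed

text \<open>Both claims are proved together: continuity of the next root needs the current value off
  the branch cut, and being real and at least 1 ensures this.\<close>

lemma isCont_c_seq:
  shows "isCont (c_seq j) 1 \<and> (\<exists>r\<ge>1. c_seq j 1 = of_real r)"
proof (induction j)
  case 0
  have "c_seq 0 = (\<lambda>u. 1)" by (rule ext) (simp add: c_seq.simps)
  then show ?case by (auto intro!: exI[of _ 1])
next
  case (Suc j)
  show ?case
  proof (cases "j = 0")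
    case True
    have "c_seq 1 = (\<lambda>u. 1)" by (rule ext) (simp add: c_seq.simps)
    then show ?thesis using True by (auto intro!: exI[of _ 1])
  next
    case False
    from Suc obtain r where r: "r \<ge> 1" "c_seq j 1 = of_real r" "isCont (c_seq j) 1" by blast
    have "c_seq (Suc j) = (\<lambda>u. 4 * of_nat j * u - 1 + 2 * csqrt (c_seq j u))"
      by (rule ext, subst c_seq.simps) (use False in simp)
    moreover have "isCont (\<lambda>u. 4 * of_nat j * u - 1 + 2 * csqrt (c_seq j u)) 1"
      using r by (intro continuous_intros isCont_csqrt') (auto simp: complex_nonpos_Reals_iff)
    moreover have "4 * of_nat j * 1 - 1 + 2 * csqrt (c_seq j 1) = of_real (4 * real j - 1 + 2 * sqrt r)"
      using r of_real_sqrt[of r] by simp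
    moreover have "4 * real j - 1 + 2 * sqrt r \<ge> 1"
      using r False real_sqrt_ge_zero[of r] by (cases j) auto
    ultimately show ?thesis by (metis (no_types, lifting))
  qed
qed

lemma c_seq_Suc: "j \<ge> 1 \<Longrightarrow> c_seq (Suc j) u = 4 * of_nat j * u - 1 + 2 * csqrt (c_seq j u)"
  by (subst c_seq.simps) simp

lemma isCont_csqrt_c_seq: "isCont (\<lambda>u. csqrt (c_seq j u)) 1"
  using isCont_c_seq[of j] by (intro isCont_csqrt') (auto simp: complex_nonpos_Reals_iff)

lemma csqrt_c_seq_1: "\<exists>r\<ge>1. csqrt (c_seq j 1) = of_real r"
proof -
  from isCont_c_seq[of j] obtain r where r: "r \<ge> 1" "c_seq j 1 = of_real r" by blast
  then have "csqrt (c_seq j 1) = of_real (sqrt r)" using of_real_sqrt[of r] by simp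
  moreover have "sqrt r \<ge> 1" using r by simp
  ultimately show ?thesis by blast
qed

lemma coeffs_cont_scaled_gf: "k \<ge> 1 \<Longrightarrow> coeffs_cont (scaled_gf k i)"
  unfolding coeffs_cont_def
proof
  fix n assume k: "k \<ge> 1"
  have "isCont (\<lambda>u. fps_nth (open_gf k u (Suc k - i)) m) 1" for m
    unfolding open_gf_def fps_nth_Abs_fps by (intro continuous_intros)
  with isCont_dom_sing[OF k] show "isCont (\<lambda>u. fps_nth (scaled_gf k i u) n) 1"
    by (cases n) (auto simp: fps_nth_scaled_gf_Suc intro!: continuous_intros)
qed

lemma fps_nonneg_scaled_gf: "fps_nonneg (scaled_gf k i 1)"
  unfolding fps_nonneg_def
proof
  fix n
  have s: "dom_sing k 1 \<in> \<real>\<^sub>\<ge>\<^sub>0" unfolding dom_sing_1 by simp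
  have "fps_nth (open_gf k 1 (Suc k - i)) m \<in> \<real>\<^sub>\<ge>\<^sub>0" for m
    by (simp add: open_gf_def)
  with s show "fps_nth (scaled_gf k i 1) n \<in> \<real>\<^sub>\<ge>\<^sub>0"
    by (cases n) (auto simp: fps_nth_scaled_gf_Suc intro!: nonneg_Reals_mult_I nonneg_Reals_pow_I)
qed

text \<open>Level 1 contributes the root of 1 + \<beta> over 2 sqrt \<pi>, and each further level
  one factor \<open>1 / csqrt (c_seq l u)\<close>. A product of roots, rather than the root of the
  product, avoids branch questions during the induction.\<close>

definition kappa :: "nat \<Rightarrow> nat \<Rightarrow> complex \<Rightarrow> complex" where
  "kappa k i u = csqrt (4 * csqrt (of_nat k * u) * dom_sing k u) / (2 * of_real (sqrt pi)) /
     (\<Prod>l = 2..i. csqrt (c_seq l u))"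

lemma isCont_kappa:
  assumes "k \<ge> 1"
  shows "isCont (kappa k i) 1 \<and> (\<exists>r>0. kappa k i 1 = of_real r)"
proof -
  have s1: "csqrt (of_nat k) = of_real (sqrt (real k))"
    using of_real_sqrt[of "real k"] by simp
  define a where "a = 4 * sqrt (real k) * (1 / (1 + 2 * sqrt (real k)))"
  have a: "a > 0" using assms by (auto simp: a_def intro!: divide_pos_pos mult_pos_pos add_pos_pos)
  have a1: "4 * csqrt (of_nat k * 1) * dom_sing k 1 = of_real a"
    by (simp add: dom_sing_1 s1 a_def)
  have "\<forall>l. \<exists>r. r \<ge> 1 \<and> csqrt (c_seq l 1) = of_real r" using csqrt_c_seq_1 by blast
  then obtain r where r: "\<And>l. r l \<ge> (1::real)" "\<And>l. csqrt (c_seq l 1) = of_real (r l)"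
    by metis
  have p: "(\<Prod>l = 2..i. csqrt (c_seq l 1)) = of_real (\<Prod>l = 2..i. r l)"
    by (simp add: r)
  have p0: "(\<Prod>l = 2..i. r l) > 0"
    using r(1) by (intro prod_pos) (auto intro: less_le_trans[OF zero_less_one])
  have "isCont (\<lambda>u. csqrt (4 * csqrt (of_nat k * u) * dom_sing k u)) 1"
    using a by (intro isCont_csqrt' continuous_intros isCont_csqrt_of_nat_mult isCont_dom_sing assms)
      (simp only: a1, simp)
  then have "isCont (kappa k i) 1"
    unfolding kappa_def using p0
    by (intro continuous_intros isCont_csqrt_c_seq) (simp_all only: p of_real_eq_0_iff, auto)
  moreover have "kappa k i 1 = of_real (sqrt a / (2 * sqrt pi) / (\<Prod>l = 2..i. r l))"
    unfolding kappa_def a1 p using a of_real_sqrt[of a] by simp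
  moreover have "sqrt a / (2 * sqrt pi) / (\<Prod>l = 2..i. r l) > 0"
    using a p0 by (intro divide_pos_pos mult_pos_pos) auto
  ultimately show ?thesis by blast
qed

lemma loc_bdd_kappa: "k \<ge> 1 \<Longrightarrow> loc_bdd (kappa k i)"
  using isCont_kappa by (intro isCont_imp_loc_bdd) blast

section \<open>Singular expansion of each level\<close>

lemma rsq_asymp_isqrt_fps: "rsq_asymp (\<lambda>u. of_real (1 / sqrt pi)) (\<lambda>u. isqrt_fps)"
proof -
  have "norm (fps_nth (isqrt_fps - fps_const (of_real (1 / sqrt pi)) * rsq_fps) n) \<le> 2 * rsq n ^ 2" for n
  proof -
    have "fps_nth (isqrt_fps - fps_const (of_real (1 / sqrt pi)) * rsq_fps) n = of_real (isqrt_coeff n - rsq n / sqrt pi)"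
      by (simp add: isqrt_fps_def rsq_fps_def)
    then show ?thesis using isqrt_coeff_asymp[of n] by (simp only: norm_of_real)
  qed
  then show ?thesis unfolding rsq_asymp_def unif_O_def by (intro exI[of _ 2]) auto
qed

text \<open>Formal power series over a field form an integral domain, so only a sign is open and the
  constant coefficient decides it.\<close>

lemma fps_power2_eq_1:
  fixes f :: "complex fps"
  assumes "f ^ 2 = 1" "fps_nth f 0 = 1"
  shows "f = 1"
proof -
  from assms(1) have "f = 1 \<or> f = - 1" by (simp add: power2_eq_1_iff)
  then show ?thesis using assms(2) by auto
qed

text \<open>
  The coefficients are controlled through those of \<open>z P'\<close>, since the error term \<open>O(n\<^bsup>-1\<^esup>)\<close> for
  \<open>n p\<^sub>n\<close> is the relative error \<open>O(n\<^bsup>-1/2\<^esup>)\<close> of the theorem.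
\<close>

definition singular_expansion :: "nat \<Rightarrow> nat \<Rightarrow> bool" where
  "singular_expansion k i \<longleftrightarrow> rsq_asymp (kappa k i) (\<lambda>u. fps_X * fps_deriv (scaled_gf k i u)) \<and>
     (\<forall>\<^sub>F u in nhds 1. fps_ev (scaled_gf k i u) = 1 - dom_sing k u * csqrt (c_seq i u))"

lemma singular_expansion_unif_O: "k \<ge> 1 \<Longrightarrow> singular_expansion k i \<Longrightarrow> unif_O (scaled_gf k i) rsq3"
  unfolding singular_expansion_def using rsq_asymp_deriv_imp_unif_O[OF _ loc_bdd_kappa] by auto

text \<open>Everything is explicit here: \<open>Y\<close> is the square root of (1 - z) (1 + \<beta>
  z), its inverse is \<open>isqrt_fps * U u\<close>, and differentiating the square of
  \<open>Y\<close> gives the derivative of the series.\<close>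

lemma singular_expansion_1:
  assumes k: "k \<ge> 1"
  shows "singular_expansion k 1"
proof -
  define \<rho> where "\<rho> = dom_sing k"
  define s where "s = (\<lambda>u. csqrt (of_nat k * u))"
  \<comment> \<open>Since \<rho> (1 + 2 s) = 1, the second factor of the discriminant becomes 1 +
    \<beta> z after rescaling.\<close>
  define \<beta> where "\<beta> = (\<lambda>u. (2 * s u - 1) * \<rho> u)"
  define U where "U = (\<lambda>u. isqrt_fps oo (fps_const (- \<beta> u) * fps_X))"
  define Y where "Y = (\<lambda>u. 1 - fps_const (\<rho> u) * fps_X - scaled_gf k 1 u)"
  \<comment> \<open>The cofactor of \<open>isqrt_fps\<close> in -z Y'; it lies in the
    algebra.\<close>
  define q where "q = (\<lambda>u. fps_const (- (\<beta> u - 1) / 2) * fps_X * U u + fps_const (\<beta> u) * (fps_X * fps_X * U u))"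
  have rs: "\<rho> u + 2 * s u * \<rho> u = 1" for u
    using dom_sing_csqrt[of k u] by (simp add: \<rho>_def s_def algebra_simps)
  have \<beta>: "1 + \<beta> u = 4 * s u * \<rho> u" for u
    using rs[of u] by (simp add: \<beta>_def algebra_simps)
  have s2: "s u ^ 2 = of_nat k * u" for u by (simp add: s_def)
  have cont: "isCont \<rho> 1" "isCont s 1"
    using k by (auto simp: \<rho>_def s_def isCont_dom_sing isCont_csqrt_of_nat_mult)
  then have cont_\<beta>: "isCont \<beta> 1" unfolding \<beta>_def by (intro continuous_intros)
  have "norm (\<beta> 1) < 1"
  proof -
    define t where "t = sqrt (real k)"
    have t: "t \<ge> 1" using k by (simp add: t_def)
    have "s 1 = of_real t" using of_real_sqrt[of "real k"] by (simp add: s_def t_def)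
    then have "\<beta> 1 = of_real ((2 * t - 1) * (1 / (1 + 2 * t)))"
      by (simp add: \<beta>_def \<rho>_def dom_sing_1 t_def)
    then have "norm (\<beta> 1) = \<bar>(2 * t - 1) * (1 / (1 + 2 * t))\<bar>" by (simp only: norm_of_real)
    also have "\<dots> < 1" using t by (simp add: abs_mult)
    finally show ?thesis .
  qed
  then obtain \<gamma> where \<gamma>: "norm (\<beta> 1) < \<gamma>" "\<gamma> < 1" using dense by blast
  have ev\<beta>: "\<forall>\<^sub>F u in nhds 1. norm (\<beta> u) < \<gamma>"
    by (rule eventually_norm_less_isCont[OF cont_\<beta> \<gamma>(1)])
  have U: "unif_O U rsq3"
    unfolding U_def
  proof (rule unif_O_isqrt_compose)
    show "unif_O (\<lambda>u. fps_const (- \<beta> u) * fps_X) rsq3"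
      using cont_\<beta> by (intro unif_O_intros isCont_imp_loc_bdd continuous_intros)
    show "\<forall>\<^sub>F u in nhds 1. \<forall>N. (\<Sum>i\<le>N. norm (fps_nth (fps_const (- \<beta> u) * fps_X) i)) \<le> \<gamma>"
      using ev\<beta>
    proof eventually_elim
      case (elim u)
      show ?case
      proof
        fix N
        have "(\<Sum>i\<le>N. norm (fps_nth (fps_const (- \<beta> u) * fps_X) i)) = (\<Sum>i\<le>N. if i = 1 then norm (\<beta> u) else 0)"
          by (intro sum.cong) auto
        also have "\<dots> \<le> \<gamma>" using elim order_trans[OF norm_ge_zero less_imp_le[OF elim]] by simp
        finally show "(\<Sum>i\<le>N. norm (fps_nth (fps_const (- \<beta> u) * fps_X) i)) \<le> \<gamma>" .
      qed
    qed
  qed fact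
  \<comment> \<open>The binomial series gives the value of \<open>U u\<close> as (1 +
    \<beta>)^(-1/2); the factor 1 + \<beta> turns it into a principal root.\<close>
  have evU: "\<forall>\<^sub>F u in nhds 1. (1 + \<beta> u) * fps_ev (U u) = csqrt (4 * s u * \<rho> u)"
    using ev\<beta>
  proof eventually_elim
    case (elim u)
    then have lt: "norm (\<beta> u) < 1" using \<gamma>(2) by linarith
    then have nz: "1 + \<beta> u \<noteq> 0" by (metis add_eq_0_iff norm_minus_cancel norm_one less_irrefl)
    have "fps_nth (U u) = (\<lambda>n. ((-1/2) gchoose n) * \<beta> u ^ n)"
    proof
      fix n
      have "fps_nth (U u) n = (- \<beta> u) ^ n * of_real (isqrt_coeff n)"
        by (simp only: U_def fps_compose_linear) (simp add: isqrt_fps_def)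
      also have "\<dots> = ((-1) ^ n * (-1) ^ n) * (((-1/2) gchoose n) * \<beta> u ^ n)"
        unfolding isqrt_coeff_gbinomial by (subst power_minus) (simp only: mult_ac)
      finally show "fps_nth (U u) n = ((-1/2) gchoose n) * \<beta> u ^ n"
        by (simp flip: power_mult_distrib)
    qed
    then have "fps_ev (U u) = (1 + \<beta> u) powr (-1/2)"
      unfolding fps_ev_def using gen_binomial_complex[OF lt, of "-1/2"] by (simp add: sums_iff)
    then have "(1 + \<beta> u) * fps_ev (U u) = (1 + \<beta> u) powr 1 * (1 + \<beta> u) powr (-1/2)"
      using nz by simp
    also have "\<dots> = csqrt (1 + \<beta> u)"
      unfolding csqrt_conv_powr powr_add[symmetric] by simp
    finally show ?case by (simp add: \<beta>)
  qed
  have Y2: "Y u ^ 2 = (1 - fps_X) * (1 + fps_const (\<beta> u) * fps_X)" for u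
  proof -
    let ?r = "fps_const (\<rho> u)" and ?s = "fps_const (s u)" and ?P = "scaled_gf k 1 u"
    have sat: "open_gf k u (Suc k) = open_gf k u (Suc k - 1)" by (simp add: open_gf_saturated)
    have "?P = fps_const (2 * dom_sing k u ^ 2 * (of_nat k * u)) * fps_X ^ 2 +
        fps_const (dom_sing k u) * fps_X * ?P + fps_const (1 / 2) * ?P ^ 2"
      by (rule scaled_gf_rec[OF _ _ refl sat]) auto
    then have "2 * ?P = 2 * (fps_const (2 * dom_sing k u ^ 2 * (of_nat k * u)) * fps_X ^ 2 +
        fps_const (dom_sing k u) * fps_X * ?P + fps_const (1 / 2) * ?P ^ 2)"
      by (rule arg_cong)
    also have "fps_const (2 * dom_sing k u ^ 2 * (of_nat k * u)) = 2 * ?r ^ 2 * ?s ^ 2"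
      by (simp add: \<rho>_def s2 numeral_fps_const fps_const_power)
    also have "2 * (2 * ?r ^ 2 * ?s ^ 2 * fps_X ^ 2 + fps_const (dom_sing k u) * fps_X * ?P + fps_const (1 / 2) * ?P ^ 2)
       = 4 * ?r ^ 2 * ?s ^ 2 * fps_X ^ 2 + 2 * ?r * fps_X * ?P + (2 * fps_const (1 / 2)) * ?P ^ 2"
      unfolding \<rho>_def by algebra
    also have "2 * fps_const (1 / 2) = (1 :: complex fps)" by (simp add: numeral_fps_const)
    finally have P: "2 * ?P = 4 * ?r ^ 2 * ?s ^ 2 * fps_X ^ 2 + 2 * ?r * fps_X * ?P + ?P ^ 2" by simp
    have rs': "?r + 2 * ?s * ?r = 1"
      using arg_cong[OF rs[of u], of fps_const] by (simp add: numeral_fps_const)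
    have b: "fps_const (\<beta> u) = (2 * ?s - 1) * ?r"
      by (simp add: \<beta>_def numeral_fps_const flip: fps_const_sub fps_const_1_eq_1)
    show ?thesis
      \<comment> \<open>Completing the square in \<open>P\<close> produces the discriminant, which
        \<open>rs'\<close> factors.\<close>
      unfolding Y_def b using P rs' by algebra
  qed
  have BU: "isqrt_fps ^ 2 * (1 - fps_X) = 1" "U u ^ 2 * (1 + fps_const (\<beta> u) * fps_X) = 1" for u
    using isqrt_fps_square isqrt_fps_compose_square[of "fps_const (- \<beta> u) * fps_X"]
    by (simp_all add: U_def flip: fps_const_neg)
  have YBU: "Y u * isqrt_fps * U u = 1" for u
  proof (rule fps_power2_eq_1)
    have "(Y u * isqrt_fps * U u) ^ 2 = (isqrt_fps ^ 2 * (1 - fps_X)) * (U u ^ 2 * (1 + fps_const (\<beta> u) * fps_X))"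
      unfolding power_mult_distrib Y2 by (simp only: mult_ac)
    then show "(Y u * isqrt_fps * U u) ^ 2 = 1" by (simp only: BU) simp
    show "fps_nth (Y u * isqrt_fps * U u) 0 = 1"
      by (simp add: Y_def U_def isqrt_fps_def isqrt_coeff_def)
  qed
  have dP: "fps_X * fps_deriv (scaled_gf k 1 u) = isqrt_fps * q u + fps_const (- \<rho> u) * fps_X" for u
  proof -
    have "2 * (Y u * fps_deriv (Y u)) = fps_deriv (Y u ^ 2)"
      by (simp add: power2_eq_square)
    also have "\<dots> = fps_const (\<beta> u - 1) - 2 * fps_const (\<beta> u) * fps_X"
      unfolding Y2 by (simp add: algebra_simps flip: fps_const_sub fps_const_1_eq_1)
    finally have *: "2 * (Y u * fps_deriv (Y u)) = fps_const (\<beta> u - 1) - 2 * fps_const (\<beta> u) * fps_X" .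
    have "2 * fps_deriv (Y u) = (2 * (Y u * fps_deriv (Y u))) * isqrt_fps * U u"
      using YBU[of u] by (metis (no_types, lifting) mult.assoc mult.commute mult.right_neutral)
    then have dY: "2 * fps_deriv (Y u) = (fps_const (\<beta> u - 1) - 2 * fps_const (\<beta> u) * fps_X) * isqrt_fps * U u"
      unfolding * .
    have dP: "fps_deriv (scaled_gf k 1 u) = - fps_const (\<rho> u) - fps_deriv (Y u)"
      by (simp add: Y_def)
    have b: "fps_const (\<beta> u - 1) = - 2 * fps_const (- (\<beta> u - 1) / 2)"
      by (simp add: numeral_fps_const)
    have n: "fps_const (- \<rho> u) = - fps_const (\<rho> u)"
      by simp
    have "2 * (fps_X * fps_deriv (scaled_gf k 1 u) - (isqrt_fps * q u + fps_const (- \<rho> u) * fps_X)) = 0"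
      unfolding dP q_def n using dY b by algebra
    then show ?thesis unfolding mult_eq_0_iff right_minus_eq by simp
  qed
  have q: "unif_O q rsq3"
    unfolding q_def using cont_\<beta> U by (intro unif_O_intros isCont_imp_loc_bdd continuous_intros) auto
  have evq: "\<forall>\<^sub>F u in nhds 1. of_real (1 / sqrt pi) * fps_ev (q u) = kappa k 1 u"
    using evU unif_O_abs_summable[OF U]
  proof eventually_elim
    case (elim u)
    have "fps_ev (q u) = (- (\<beta> u - 1) / 2) * fps_ev (U u) + \<beta> u * fps_ev (U u)"
      unfolding q_def using elim(2)
      by (simp add: fps_ev_add fps_ev_mult abs_summable_add abs_summable_mult)
    also have "\<dots> = (1 + \<beta> u) * fps_ev (U u) / 2" by (simp add: field_simps)
    finally have e: "fps_ev (q u) = csqrt (4 * s u * \<rho> u) / 2" unfolding elim(1) .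
    show ?case unfolding e by (simp add: kappa_def s_def \<rho>_def)
  qed
  have "rsq_asymp (\<lambda>u. of_real (1 / sqrt pi) * fps_ev (q u)) (\<lambda>u. isqrt_fps * q u)"
    by (intro rsq_asymp_mult rsq_asymp_isqrt_fps q isCont_imp_loc_bdd) auto
  then have "rsq_asymp (\<lambda>u. of_real (1 / sqrt pi) * fps_ev (q u)) (\<lambda>u. isqrt_fps * q u + fps_const (- \<rho> u) * fps_X)"
    by (rule rsq_asymp_add)
      (intro unif_O_rsq3_imp_rsq2 unif_O_intros isCont_imp_loc_bdd continuous_intros cont)
  then have as: "rsq_asymp (kappa k 1) (\<lambda>u. fps_X * fps_deriv (scaled_gf k 1 u))"
    by (rule rsq_asymp_cong) (use evq dP in \<open>auto elim: eventually_mono\<close>)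
  then have P: "unif_O (scaled_gf k 1) rsq3"
    by (rule rsq_asymp_deriv_imp_unif_O) (auto intro: loc_bdd_kappa k)
  \<comment> \<open>The square of \<open>Y\<close> vanishes at z = 1, hence so does
    \<open>Y\<close>; this is the claim because \<open>c_seq 1 u = 1\<close>.\<close>
  have "\<forall>\<^sub>F u in nhds 1. fps_ev (scaled_gf k 1 u) = 1 - dom_sing k u * csqrt (c_seq 1 u)"
    using unif_O_abs_summable[OF P]
  proof eventually_elim
    case (elim u)
    then have Y: "abs_summable (Y u)"
      unfolding Y_def by (intro abs_summable_diff abs_summable_mult abs_summable_simps)
    have "fps_ev (Y u) ^ 2 = fps_ev (Y u ^ 2)" using Y by (simp add: fps_ev_power)
    also have "\<dots> = 0"
      unfolding Y2 by (subst fps_ev_mult) (simp_all add: fps_ev_diff abs_summable_diff abs_summable_add abs_summable_mult)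
    finally have "fps_ev (Y u) = 0" by simp
    moreover have "fps_ev (Y u) = 1 - \<rho> u - fps_ev (scaled_gf k 1 u)"
      unfolding Y_def using elim by (simp add: fps_ev_diff fps_ev_mult abs_summable_diff abs_summable_mult)
    ultimately show ?case by (simp add: \<rho>_def c_seq.simps)
  qed
  with as show ?thesis by (simp add: singular_expansion_def)
qed

text \<open>\<open>rsq_asymp_mult\<close> is applied twice, with the factors \<rho> z and
  \<open>Q\<close>. Together they multiply \<kappa> by \<rho> Q(1), which is
  \<open>1 / csqrt (c_seq (Suc i) u)\<close>.\<close>

lemma singular_expansion_Suc:
  assumes k: "k \<ge> 1" and i: "1 \<le> i" "i \<le> k" and inv: "singular_expansion k i"
  shows "singular_expansion k (Suc i)"
proof -
  define \<rho> where "\<rho> = dom_sing k"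
  define P where "P = scaled_gf k i"
  define R where "R = scaled_gf k (Suc i)"
  define a where "a = (\<lambda>u. 2 * \<rho> u ^ 2 * (of_nat (k - i) * u))"
  define g where "g = (\<lambda>u. fps_const (a u) * fps_X ^ 2 + fps_const (\<rho> u) * fps_X * P u)"
  define h where "h = (\<lambda>u. 2 * g u)"
  define Q where "Q = (\<lambda>u. isqrt_fps oo h u)"
  define c where "c = (\<lambda>u. \<rho> u * csqrt (c_seq (Suc i) u))"
  have cont_\<rho>: "isCont \<rho> 1" using k by (simp add: \<rho>_def isCont_dom_sing)
  have cont_a: "isCont a 1" unfolding a_def by (intro continuous_intros cont_\<rho>)
  note bdd = isCont_imp_loc_bdd[OF cont_\<rho>] isCont_imp_loc_bdd[OF cont_a]
  have P: "unif_O P rsq3" unfolding P_def by (rule singular_expansion_unif_O[OF k inv])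
  have g: "unif_O g rsq3" unfolding g_def power2_eq_square by (intro unif_O_intros bdd P)
  have h: "unif_O h rsq3"
    unfolding h_def mult_2 by (rule unif_O_add[OF g g])
  have evg: "\<forall>\<^sub>F u in nhds 1. 1 - 2 * fps_ev (g u) = c u ^ 2"
    using inv[unfolded singular_expansion_def, THEN conjunct2] unif_O_abs_summable[OF P]
  proof eventually_elim
    case (elim u)
    define s where "s = csqrt (of_nat k * u)"
    have r: "\<rho> u * (1 + 2 * s) = 1" unfolding \<rho>_def s_def by (rule dom_sing_csqrt)
    have s: "s ^ 2 = of_nat k * u" by (simp add: s_def)
    have "fps_ev (g u) = a u + \<rho> u * fps_ev (P u)"
      unfolding g_def using elim(2)
      by (simp add: fps_ev_add fps_ev_mult fps_ev_power abs_summable_mult abs_summable_power)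
    also have "fps_ev (P u) = 1 - \<rho> u * csqrt (c_seq i u)"
      using elim(1) by (simp add: P_def \<rho>_def)
    finally have eg: "fps_ev (g u) = a u + \<rho> u * (1 - \<rho> u * csqrt (c_seq i u))" .
    have "1 - 2 * fps_ev (g u) = 1 - 2 * \<rho> u - 4 * \<rho> u ^ 2 * of_nat (k - i) * u + 2 * \<rho> u ^ 2 * csqrt (c_seq i u)"
      unfolding eg a_def by algebra
    \<comment> \<open>Writing 1 as \<rho> (1 + 2 s) makes the expression homogeneous of degree 2 in
      \<rho>, so that the recursion of \<open>c_seq\<close> appears.\<close>
    also have "1 - 2 * \<rho> u = (\<rho> u * (1 + 2 * s)) ^ 2 - 2 * \<rho> u * (\<rho> u * (1 + 2 * s))"
      unfolding r by simp
    also have "\<dots> = \<rho> u ^ 2 * (4 * (of_nat k * u) - 1)"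
      unfolding s[symmetric] by algebra
    also have "of_nat (k - i) = (of_nat k - of_nat i :: complex)" using i by simp
    also have "\<rho> u ^ 2 * (4 * (of_nat k * u) - 1) - 4 * \<rho> u ^ 2 * (of_nat k - of_nat i) * u + 2 * \<rho> u ^ 2 * csqrt (c_seq i u)
       = \<rho> u ^ 2 * c_seq (Suc i) u"
      unfolding c_seq_Suc[OF i(1)] by algebra
    finally show ?case by (simp add: c_def power_mult_distrib)
  qed
  have cont_c: "isCont c 1" unfolding c_def by (intro continuous_intros cont_\<rho> isCont_csqrt_c_seq)
  obtain r where r: "r > 0" "c 1 = of_real r"
  proof -
    obtain r where r: "r \<ge> 1" "csqrt (c_seq (Suc i) 1) = of_real r"
      using csqrt_c_seq_1 by blast
    show ?thesis
    proof (rule that)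
      show "c 1 = of_real (1 / (1 + 2 * sqrt (real k)) * r)"
        unfolding c_def \<rho>_def dom_sing_1 r by simp
      show "1 / (1 + 2 * sqrt (real k)) * r > 0"
        using r by (intro mult_pos_pos divide_pos_pos add_pos_nonneg) auto
    qed
  qed
  have cc: "coeffs_cont g"
    unfolding g_def P_def
    by (intro coeffs_cont_add coeffs_cont_mult coeffs_cont_const coeffs_cont_fixed coeffs_cont_scaled_gf cont_\<rho> cont_a k)
  have nn: "fps_nonneg (g 1)"
  proof -
    have "\<rho> 1 \<in> \<real>\<^sub>\<ge>\<^sub>0" by (simp add: \<rho>_def dom_sing_1)
    moreover have "a 1 \<in> \<real>\<^sub>\<ge>\<^sub>0"
      unfolding a_def using \<open>\<rho> 1 \<in> \<real>\<^sub>\<ge>\<^sub>0\<close> by (intro nonneg_Reals_mult_I nonneg_Reals_pow_I) auto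
    ultimately show ?thesis
      unfolding g_def P_def
      by (intro fps_nonneg_add fps_nonneg_mult fps_nonneg_power fps_nonneg_const fps_nonneg_X fps_nonneg_scaled_gf)
  qed
  define S where "S = (\<lambda>u. \<Sum>n. norm (fps_nth (g u) n))"
  have "isCont S 1"
    unfolding S_def using cc by (intro isCont_suminf_norm g) (auto simp: coeffs_cont_def)
  \<comment> \<open>At \<open>u = 1\<close> the norm sum is the value of \<open>g\<close> itself,
    namely (1 - r^2) / 2 with r > 0.\<close>
  have "S 1 < 1 / 2"
  proof -
    have "S 1 = Re (fps_ev (g 1))"
      unfolding S_def using eventually_nhds_x_imp_x[OF unif_O_abs_summable[OF g]]
      by (intro fps_nonneg_suminf_norm nn)
    moreover have "Re (1 - 2 * fps_ev (g 1)) = r ^ 2"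
      using eventually_nhds_x_imp_x[OF evg] r by (simp flip: of_real_power)
    ultimately have "1 - 2 * S 1 = r ^ 2" by simp
    then show ?thesis using zero_less_power[OF r(1), of 2] by linarith
  qed
  then obtain \<gamma> where \<gamma>: "S 1 < \<gamma>" "\<gamma> < 1 / 2" using dense by blast
  have evS: "\<forall>\<^sub>F u in nhds 1. S u < \<gamma>"
  proof -
    have "(S \<longlongrightarrow> S 1) (at 1)" using \<open>isCont S 1\<close> by (simp add: isCont_def)
    then have "\<forall>\<^sub>F u in at 1. S u < \<gamma>" using \<gamma>(1) by (rule order_tendstoD)
    then show ?thesis using \<gamma>(1) by (auto simp: eventually_nhds_conv_at)
  qed
  have Q: "unif_O Q rsq3"
    unfolding Q_def
  proof (rule unif_O_isqrt_compose[OF h])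
    show "\<forall>\<^sub>F u in nhds 1. \<forall>N. (\<Sum>i\<le>N. norm (fps_nth (h u) i)) \<le> 2 * \<gamma>"
      using evS unif_O_abs_summable[OF g]
    proof eventually_elim
      case (elim u)
      show ?case
      proof
        fix N
        have "(\<Sum>i\<le>N. norm (fps_nth (h u) i)) = 2 * (\<Sum>i\<le>N. norm (fps_nth (g u) i))"
          by (simp add: h_def numeral_fps_const norm_mult sum_distrib_left)
        also have "(\<Sum>i\<le>N. norm (fps_nth (g u) i)) \<le> S u"
          unfolding S_def using elim(2) by (intro sum_le_suminf) (auto simp: abs_summable_def)
        finally show "(\<Sum>i\<le>N. norm (fps_nth (h u) i)) \<le> 2 * \<gamma>" using elim(1) by linarith
      qed
    qed
    show "2 * \<gamma> < 1" using \<gamma>(2) by simp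
  qed
  have g0: "fps_nth (g u) 0 = 0" for u
    by (simp add: g_def P_def mult.assoc)
  have h0: "fps_nth (h u) 0 = 0" for u
    by (simp add: h_def g0)
  have Q2: "Q u ^ 2 * (1 - 2 * g u) = 1" for u
    using isqrt_fps_compose_square[OF h0, of u] by (simp add: Q_def h_def)
  have Rg: "R u = g u + fps_const (1 / 2) * R u ^ 2" for u
  proof -
    have "open_gf k u (Suc (k - i)) = open_gf k u (Suc k - i)" using i by (simp add: Suc_diff_le)
    from scaled_gf_rec[OF _ _ refl this, of "Suc i"] show ?thesis
      by (simp add: R_def g_def a_def P_def \<rho>_def)
  qed
  have R2: "(1 - R u) ^ 2 = 1 - 2 * g u" for u
  proof -
    have "2 * R u = 2 * g u + (2 * fps_const (1 / 2)) * R u ^ 2"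
      by (subst Rg) (simp add: distrib_left mult.assoc)
    also have "2 * fps_const (1 / 2) = (1 :: complex fps)" by (simp add: numeral_fps_const)
    finally show ?thesis by (simp add: power2_eq_square algebra_simps)
  qed
  have QR: "Q u * (1 - R u) = 1" for u
  proof (rule fps_power2_eq_1)
    show "(Q u * (1 - R u)) ^ 2 = 1" unfolding power_mult_distrib R2 by (rule Q2)
    show "fps_nth (Q u * (1 - R u)) 0 = 1"
      by (simp add: Q_def R_def isqrt_fps_def isqrt_coeff_def)
  qed
  \<comment> \<open>Since \<open>Q\<close> inverts \<open>1 - R\<close>, the relation 1 - R = Q (1 -
    R)^2 = Q (1 - h) expresses \<open>R\<close> inside the algebra.\<close>
  have R: "unif_O R rsq3"
  proof (rule unif_O_cong)
    show "unif_O (\<lambda>u. 1 - Q u * (1 - h u)) rsq3" by (intro unif_O_intros Q h)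
    have "1 - R u = Q u * (1 - 2 * g u)" for u
      using QR[of u] unfolding R2[symmetric] power2_eq_square by (metis mult.assoc mult_1)
    then show "\<forall>\<^sub>F u in nhds 1. 1 - Q u * (1 - h u) = R u"
      by (auto simp: h_def algebra_simps)
  qed
  \<comment> \<open>The squares of Q(1) and \<open>1 / c\<close> agree. At \<open>u = 1\<close> both
    are positive, \<open>Q\<close> having nonnegative coefficients and constant coefficient 1; by
    continuity the real parts stay positive nearby, which fixes the sign.\<close>
  have evQ: "\<forall>\<^sub>F u in nhds 1. fps_ev (Q u) * c u = 1"
  proof -
    have "coeffs_cont Q"
      unfolding Q_def h_def by (intro coeffs_cont_isqrt_compose coeffs_cont_mult coeffs_cont_fixed cc)
    then have "isCont (\<lambda>u. fps_ev (Q u)) 1"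
      by (intro isCont_fps_ev Q) (auto simp: coeffs_cont_def)
    moreover have "Re (fps_ev (Q 1)) > 0"
    proof -
      have sm: "abs_summable (Q 1)" using eventually_nhds_x_imp_x[OF unif_O_abs_summable[OF Q]] .
      have "fps_nonneg (Q 1)"
        unfolding Q_def h_def mult_2 by (intro fps_nonneg_isqrt_compose fps_nonneg_add nn)
      then have "Re (fps_ev (Q 1)) = (\<Sum>n. norm (fps_nth (Q 1) n))"
        using sm by (simp add: fps_nonneg_suminf_norm)
      also have "\<dots> \<ge> (\<Sum>n\<le>0. norm (fps_nth (Q 1) n))"
        using sm by (intro sum_le_suminf) (auto simp: abs_summable_def)
      also have "(\<Sum>n\<le>0. norm (fps_nth (Q 1) n)) = 1"
        by (simp add: Q_def isqrt_fps_def isqrt_coeff_def)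
      finally show ?thesis by linarith
    qed
    ultimately have pos: "\<forall>\<^sub>F u in nhds 1. Re (fps_ev (Q u)) > 0" by (rule isCont_Re_pos)
    have "isCont (\<lambda>u. 1 / c u) 1" using r by (intro continuous_intros cont_c) auto
    then have pos': "\<forall>\<^sub>F u in nhds 1. Re (1 / c u) > 0"
      by (rule isCont_Re_pos) (use r in simp)
    from pos pos' evg unif_O_abs_summable[OF Q] unif_O_abs_summable[OF g] show ?thesis
    proof eventually_elim
      case (elim u)
      have cn: "c u \<noteq> 0" using elim(2) by auto
      have "fps_ev (Q u ^ 2 * (1 - 2 * g u)) = fps_ev (Q u) ^ 2 * (1 - 2 * fps_ev (g u))"
        using elim(4,5)
        by (simp add: fps_ev_mult fps_ev_power fps_ev_diff abs_summable_mult abs_summable_power abs_summable_diff numeral_fps_const)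
      then have "fps_ev (Q u) ^ 2 * c u ^ 2 = 1"
        using elim(3) by (simp add: Q2)
      then have "fps_ev (Q u) ^ 2 = (1 / c u) ^ 2"
        using cn by (simp add: field_simps)
      then have "fps_ev (Q u) = 1 / c u"
        using elim(1,2) by (rule eq_if_power2_eq_Re_pos)
      then show ?case using cn by simp
    qed
  qed
  have evR: "\<forall>\<^sub>F u in nhds 1. fps_ev (R u) = 1 - c u"
    using evQ unif_O_abs_summable[OF Q] unif_O_abs_summable[OF R]
  proof eventually_elim
    case (elim u)
    have "fps_ev (Q u * (1 - R u)) = fps_ev (Q u) * (1 - fps_ev (R u))"
      using elim(2,3) by (simp add: fps_ev_mult fps_ev_diff abs_summable_diff)
    then have "fps_ev (Q u) * (1 - fps_ev (R u)) = fps_ev (Q u) * c u"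
      using elim(1) by (simp add: QR)
    moreover have "fps_ev (Q u) \<noteq> 0" using elim(1) by auto
    ultimately have "1 - fps_ev (R u) = c u" by simp
    then show ?case by (simp add: algebra_simps)
  qed
  have dR: "fps_X * fps_deriv (R u) = ((fps_X * fps_deriv (P u)) * (fps_const (\<rho> u) * fps_X)
      + (2 * fps_const (a u) * fps_X * fps_X + fps_const (\<rho> u) * fps_X * P u)) * Q u" for u
  proof -
    have "- 2 * ((1 - R u) * fps_deriv (R u)) = fps_deriv ((1 - R u) ^ 2)"
      by (simp add: power2_eq_square algebra_simps)
    also have "\<dots> = - (fps_deriv (g u) + fps_deriv (g u))" unfolding R2 mult_2 by simp
    also have "\<dots> = - 2 * fps_deriv (g u)" by algebra
    finally have "(1 - R u) * fps_deriv (R u) = fps_deriv (g u)" by simp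
    then have "fps_deriv (R u) = fps_deriv (g u) * Q u"
      using QR[of u] by (metis mult.assoc mult.commute mult_1)
    moreover have "fps_deriv (g u) = fps_deriv (P u) * (fps_const (\<rho> u) * fps_X)
        + (2 * fps_const (a u) * fps_X + fps_const (\<rho> u) * P u)"
      by (simp add: g_def power2_eq_square algebra_simps)
    ultimately show ?thesis by (simp add: algebra_simps)
  qed
  have b1: "unif_O (\<lambda>u. fps_const (\<rho> u) * fps_X) rsq3" by (intro unif_O_intros bdd)
  have "loc_bdd (\<lambda>u. kappa k i u * fps_ev (fps_const (\<rho> u) * fps_X))"
    by (intro loc_bdd_mult loc_bdd_kappa k loc_bdd_fps_ev b1)
  \<comment> \<open>Only the first summand is singular at this order; the rest lies in the algebra.
    The doubled constant is written as a sum to match the closure rules.\<close>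
  moreover have "rsq_asymp (\<lambda>u. kappa k i u * fps_ev (fps_const (\<rho> u) * fps_X))
      (\<lambda>u. (fps_X * fps_deriv (P u)) * (fps_const (\<rho> u) * fps_X) +
        ((fps_const (a u) + fps_const (a u)) * fps_X * fps_X + fps_const (\<rho> u) * fps_X * P u))"
  proof (rule rsq_asymp_add[OF rsq_asymp_mult])
    show "rsq_asymp (kappa k i) (\<lambda>u. fps_X * fps_deriv (P u))"
      using inv unfolding singular_expansion_def P_def by blast
  qed (intro b1 loc_bdd_kappa k unif_O_rsq3_imp_rsq2 unif_O_intros bdd P)+
  ultimately have "rsq_asymp (\<lambda>u. (kappa k i u * fps_ev (fps_const (\<rho> u) * fps_X)) * fps_ev (Q u))
      (\<lambda>u. ((fps_X * fps_deriv (P u)) * (fps_const (\<rho> u) * fps_X) +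
        ((fps_const (a u) + fps_const (a u)) * fps_X * fps_X + fps_const (\<rho> u) * fps_X * P u)) * Q u)"
    using Q by (intro rsq_asymp_mult)
  then have "rsq_asymp (kappa k (Suc i)) (\<lambda>u. fps_X * fps_deriv (R u))"
  proof (rule rsq_asymp_cong)
    show "\<forall>\<^sub>F u in nhds 1. kappa k i u * fps_ev (fps_const (\<rho> u) * fps_X) * fps_ev (Q u) = kappa k (Suc i) u \<and>
      ((fps_X * fps_deriv (P u)) * (fps_const (\<rho> u) * fps_X) +
        ((fps_const (a u) + fps_const (a u)) * fps_X * fps_X + fps_const (\<rho> u) * fps_X * P u)) * Q u =
      fps_X * fps_deriv (R u)"
      using evQ
    proof eventually_elim
      case (elim u)
      have "csqrt (c_seq (Suc i) u) \<noteq> 0" using elim by (auto simp: c_def)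
      moreover have "fps_ev (fps_const (\<rho> u) * fps_X) = \<rho> u" by (simp add: fps_ev_mult)
      moreover have "\<rho> u * fps_ev (Q u) * csqrt (c_seq (Suc i) u) = 1"
        using elim by (simp add: c_def mult_ac)
      moreover have "(\<Prod>l = 2..Suc i. csqrt (c_seq l u)) = (\<Prod>l = 2..i. csqrt (c_seq l u)) * csqrt (c_seq (Suc i) u)"
        using i by simp
      ultimately have "kappa k i u * fps_ev (fps_const (\<rho> u) * fps_X) * fps_ev (Q u) = kappa k (Suc i) u"
        unfolding kappa_def by (simp add: divide_simps) (simp only: mult_ac | simp)+
      moreover have "fps_const (a u) + fps_const (a u) = 2 * fps_const (a u)" by (simp only: mult_2)
      ultimately show ?case by (simp only: dR simp_thms)
    qed
  qed
  with evR show ?thesis by (simp add: singular_expansion_def R_def c_def \<rho>_def)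
qed

section \<open>Assembling the levels and reading off the coefficients\<close>

lemma singular_expansion_levels:
  assumes "k \<ge> 1" "1 \<le> i" "i \<le> Suc k"
  shows "singular_expansion k i"
  using assms(2,3)
proof (induction i rule: dec_induct)
  case base
  show ?case by (rule singular_expansion_1[OF assms(1)])
next
  case (step i)
  then show ?case using singular_expansion_Suc[OF assms(1)] by simp
qed

text \<open>The extra factor z in \<open>scaled_gf\<close> shifts the index to \<open>n + 1\<close>.
  The proof gives the relative error 3/n, weakened to the order of the main error.\<close>

lemma rsq_Suc_div_Suc_approx:
  assumes "n \<ge> 1"
  shows "\<bar>rsq (Suc n) / real (Suc n) - real n powr (- (3 / 2))\<bar> \<le> 3 / sqrt (real n) * real n powr (- (3 / 2))"
proof -
  define w where "w = real n powr (- (3 / 2))"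
  have n: "real n > 0" using assms by simp
  have w: "w = 1 / (real n * sqrt (real n))"
  proof -
    have "real n powr (3 / 2) = real n powr (1 + 1 / 2)" by simp
    also have "\<dots> = real n * sqrt (real n)"
      using n by (simp only: powr_add powr_half_sqrt less_imp_le powr_one)
    finally show ?thesis unfolding w_def powr_minus_divide by (rule arg_cong)
  qed
  have s1: "sqrt (real n) \<le> real n" "1 \<le> sqrt (real n)"
    using assms by (auto intro!: real_le_lsqrt simp: power2_eq_square)
  have r: "rsq (Suc n) / real (Suc n) = 1 / (real (Suc n) * sqrt (real n + 2))"
    by (simp add: rsq_def add.commute)
  have up: "rsq (Suc n) / real (Suc n) \<le> w"
    unfolding r w using n by (intro divide_left_mono mult_mono mult_pos_pos) auto
  \<comment> \<open>A number in [0, 1] is at most its root; this reduces the lower bound to an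
    inequality of rational functions.\<close>
  have q: "real n / (real n + 2) \<le> sqrt (real n) / sqrt (real n + 2)"
  proof -
    have "x ^ 2 \<le> x" if "0 \<le> x" "x \<le> 1" for x :: real
      using that by (simp add: power2_eq_square mult_left_le)
    from this[of "real n / (real n + 2)"]
    have "sqrt ((real n / (real n + 2)) ^ 2) \<le> sqrt (real n / (real n + 2))"
      by (intro real_sqrt_le_mono) simp
    then show ?thesis by (simp add: real_sqrt_divide)
  qed
  have "1 - 3 / real n \<le> (real n / real (Suc n)) * (real n / (real n + 2))"
    using n by (simp add: divide_simps) (simp add: algebra_simps)
  also have "\<dots> \<le> (real n / real (Suc n)) * (sqrt (real n) / sqrt (real n + 2))"
    by (intro mult_left_mono q) auto
  finally have "w * (1 - 3 / real n) \<le> w * ((real n / real (Suc n)) * (sqrt (real n) / sqrt (real n + 2)))"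
    by (rule mult_left_mono) (simp add: w_def)
  also have "\<dots> = rsq (Suc n) / real (Suc n)"
    unfolding r w using n by simp
  finally have "w - rsq (Suc n) / real (Suc n) \<le> 3 / real n * w"
    by (simp add: algebra_simps)
  also have "\<dots> \<le> 3 / sqrt (real n) * w"
    using s1 n by (intro mult_right_mono divide_left_mono mult_pos_pos) (auto simp: w_def)
  finally show ?thesis using up by (simp add: w_def)
qed

lemma c_seq_prod_sqrt: "(\<Prod>l = 2..m. csqrt (c_seq l u)) ^ 2 = (\<Prod>l = 2..m. c_seq l u)"
  by (simp add: prod_power_distrib)

text \<open>The squares agree for every \<open>u\<close>. Near 1 the right-hand side has positive
  real part, so it is the principal root of its square.\<close>

lemma csqrt_leading_coeff_eq:
  assumes k: "k \<ge> 1"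
  shows "\<forall>\<^sub>F u in nhds 1. csqrt ((csqrt (of_nat k * u) + 2 * of_nat k * u) /
      (4 * of_real pi * (\<Prod>l = 2..k + 1. c_seq l u))) = kappa k (k + 1) u / (2 * dom_sing k u)"
proof -
  define f where "f = (\<lambda>u. kappa k (k + 1) u / (2 * dom_sing k u))"
  have sq: "(csqrt (of_nat k * u) + 2 * of_nat k * u) / (4 * of_real pi * (\<Prod>l = 2..k + 1. c_seq l u)) = f u ^ 2" for u
  proof -
    define s where "s = csqrt (of_nat k * u)"
    have s2: "of_nat k * u = s ^ 2" by (simp add: s_def)
    have "(of_real (sqrt pi) :: complex) ^ 2 = of_real pi"
      by (simp flip: of_real_power)
    then have "f u ^ 2 = 4 * s * dom_sing k u / (4 * of_real pi) / (\<Prod>l = 2..k + 1. c_seq l u) / (4 * dom_sing k u ^ 2)"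
      unfolding f_def kappa_def power_divide power_mult_distrib c_seq_prod_sqrt power2_csqrt s_def by simp
    \<comment> \<open>One factor \<rho> remains in the denominator and is replaced through 1/\<rho>
      = 1 + 2 s.\<close>
    also have "\<dots> = s * (1 + 2 * s) / (4 * of_real pi * (\<Prod>l = 2..k + 1. c_seq l u))"
      using dom_sing_nonzero[of k u] by (simp add: dom_sing_def s_def power2_eq_square)
    also have "s * (1 + 2 * s) = s + 2 * of_nat k * u"
      unfolding mult.assoc s2 by (simp add: power2_eq_square algebra_simps)
    finally show ?thesis by (simp add: s_def)
  qed
  obtain r where r: "r > 0" "kappa k (k + 1) 1 = of_real r"
    using isCont_kappa[OF k] by blast
  have "isCont f 1"
    unfolding f_def using isCont_kappa[OF k] dom_sing_nonzero
    by (intro continuous_intros isCont_dom_sing k) auto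
  moreover have "Re (f 1) > 0"
  proof -
    have f1: "f 1 = of_real (r / (2 * (1 / (1 + 2 * sqrt (real k)))))"
      unfolding f_def r dom_sing_1 by simp
    have "r / (2 * (1 / (1 + 2 * sqrt (real k)))) > 0"
      using r(1) by (intro divide_pos_pos mult_pos_pos add_pos_nonneg) auto
    then show ?thesis unfolding f1 Re_complex_of_real .
  qed
  ultimately have "\<forall>\<^sub>F u in nhds 1. Re (f u) > 0" by (rule isCont_Re_pos)
  then show ?thesis
  proof eventually_elim
    case (elim u)
    then have "csqrt (f u ^ 2) = f u" by (intro csqrt_unique) auto
    then show ?case unfolding sq by (simp only: f_def)
  qed
qed

theorem theorem3p2:
  fixes k :: nat
  assumes "k \<ge> 1"
  shows "\<exists>\<delta>::real. \<delta> > 0 \<and> (\<exists>(E :: nat \<Rightarrow> complex \<Rightarrow> complex) (C :: real).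
           \<forall>\<^sub>F n in sequentially. \<forall>u :: complex. norm (u - 1) < \<delta> \<longrightarrow>
             fps_nth (G_series k u) n =
               csqrt ((csqrt (of_nat k * u) + 2 * of_nat k * u) /
                      (4 * of_real pi * (\<Prod>l = 2..k + 1. c_seq l u))) *
               (1 + 2 * csqrt (of_nat k * u)) ^ n * of_real (real n powr (- (3 / 2))) *
               (1 + E n u) \<and>
             norm (E n u) \<le> C / sqrt (real n))"
proof -
  define M where "M = (\<lambda>u. csqrt ((csqrt (of_nat k * u) + 2 * of_nat k * u) /
                      (4 * of_real pi * (\<Prod>l = 2..k + 1. c_seq l u))))"
  define \<kappa> where "\<kappa> = kappa k (k + 1)"
  define p where "p = scaled_gf k (k + 1)"
  define w where "w = (\<lambda>n. real n powr (- (3 / 2)))"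
  \<comment> \<open>\<open>E\<close> is the exact relative error, so the asymptotic equation is an
    identity and only the bound needs proof.\<close>
  define E where "E = (\<lambda>n u. fps_nth (p u) (Suc n) / (\<kappa> u * of_real (w n)) - 1)"
  have "singular_expansion k (k + 1)" using singular_expansion_levels[OF assms, of "k + 1"] by simp
  then have as: "rsq_asymp \<kappa> (\<lambda>u. fps_X * fps_deriv (p u))"
    by (simp add: singular_expansion_def \<kappa>_def p_def)
  obtain C where C: "C \<ge> 0" "\<forall>\<^sub>F u in nhds 1. \<forall>n. norm (fps_nth (fps_X * fps_deriv (p u) - fps_const (\<kappa> u) * rsq_fps) n) \<le> C * rsq n ^ 2"
    using as unfolding rsq_asymp_def by (rule unif_O_nonnegE) auto
  obtain r where r: "r > 0" "\<kappa> 1 = of_real r" and cont: "isCont \<kappa> 1"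
    using isCont_kappa[OF assms] unfolding \<kappa>_def by blast
  have "isCont (\<lambda>u. 1 / \<kappa> u) 1" using r by (intro continuous_intros cont) auto
  \<comment> \<open>The value at 1 is 1/r; any larger constant bounds the quotient nearby.\<close>
  from eventually_norm_less_isCont[OF this, of "2 / r"]
  have inv: "\<forall>\<^sub>F u in nhds 1. norm (1 / \<kappa> u) < 2 / r"
    using r by (simp add: norm_divide divide_strict_right_mono)
  have nz: "\<forall>\<^sub>F u in nhds 1. Re (\<kappa> u) > 0"
    by (rule isCont_Re_pos[OF cont]) (simp add: r)
  have main: "\<forall>\<^sub>F u in nhds 1. \<forall>n\<ge>1. fps_nth (G_series k u) n =
      M u * (1 + 2 * csqrt (of_nat k * u)) ^ n * of_real (w n) * (1 + E n u) \<and>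
      norm (E n u) \<le> (2 * C / r + 3) / sqrt (real n)"
    using C(2) inv nz csqrt_leading_coeff_eq[OF assms]
  proof eventually_elim
    case (elim u)
    show ?case
    proof (intro allI impI conjI)
      \<comment> \<open>At \<open>n = 0\<close> the weight \<open>w\<close> vanishes, and
        \<open>E\<close> would divide by zero.\<close>
      fix n :: nat assume n: "n \<ge> 1"
      have w: "w n > 0" using n by (simp add: w_def)
      have \<kappa>: "\<kappa> u \<noteq> 0" using elim(3) by auto
      define \<rho> where "\<rho> = dom_sing k u"
      have \<rho>: "\<rho> \<noteq> 0" by (simp add: \<rho>_def dom_sing_nonzero)
      have M: "M u = \<kappa> u / (2 * \<rho>)" using elim(4) by (simp add: M_def \<kappa>_def \<rho>_def)
      have inv\<rho>: "1 + 2 * csqrt (of_nat k * u) = 1 / \<rho>" by (simp add: \<rho>_def dom_sing_def)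
      have G: "fps_nth (p u) (Suc n) = 2 * \<rho> * \<rho> ^ n * fps_nth (G_series k u) n"
        by (simp add: p_def fps_nth_scaled_gf_Suc G_series_eq_open_gf \<rho>_def)
      show "fps_nth (G_series k u) n = M u * (1 + 2 * csqrt (of_nat k * u)) ^ n * of_real (w n) * (1 + E n u)"
        unfolding M inv\<rho> E_def G using \<rho> \<kappa> w by (simp add: power_one_over field_simps)
      have n1: "of_nat (Suc n) \<noteq> (0 :: complex)" by (rule of_nat_neq_0)
      define e where "e = of_nat (Suc n) * fps_nth (p u) (Suc n) - \<kappa> u * of_real (rsq (Suc n))"
      have e: "norm e \<le> C * rsq (Suc n) ^ 2"
        using elim(1)[THEN spec, of "Suc n"] by (simp add: e_def rsq_fps_def)
      define d where "d = rsq (Suc n) / real (Suc n) - w n"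
      \<comment> \<open>Two sources of error: \<open>e\<close> from the singular expansion, which
        yields 2 C / r, and \<open>d\<close> from replacing the weight by n^(-3/2), which yields
        3.\<close>
      have "E n u = (1 / \<kappa> u) * (e / of_nat (Suc n)) / of_real (w n) + of_real (d / w n)"
      proof -
        have "fps_nth (p u) (Suc n) = e / of_nat (Suc n) + \<kappa> u * of_real (rsq (Suc n) / real (Suc n))"
          using n1 by (simp add: e_def diff_divide_distrib del: of_nat_Suc)
        also have "rsq (Suc n) / real (Suc n) = d + w n" by (simp add: d_def)
        finally have pn: "fps_nth (p u) (Suc n) = e / of_nat (Suc n) + \<kappa> u * of_real (d + w n)" .
        have "(y + K * (D + W)) / (K * W) - 1 = (1 / K) * y / W + D / W"
          if "K \<noteq> 0" "W \<noteq> 0" for y K D W :: complex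
          using that by (simp add: field_simps)
        from this[of "\<kappa> u" "of_real (w n)" "e / of_nat (Suc n)" "of_real d"] show ?thesis
          unfolding E_def pn using w \<kappa> by simp
      qed
      also have "norm \<dots> \<le> norm ((1 / \<kappa> u) * (e / of_nat (Suc n)) / of_real (w n)) + norm (of_real (d / w n) :: complex)"
        by (rule norm_triangle_ineq)
      also have "norm (of_real (d / w n) :: complex) = \<bar>d\<bar> / w n"
        using w by (simp add: norm_divide)
      also have "\<dots> \<le> 3 / sqrt (real n)"
        using rsq_Suc_div_Suc_approx[OF n] w by (simp add: d_def w_def pos_divide_le_eq)
      also have "norm ((1 / \<kappa> u) * (e / of_nat (Suc n)) / of_real (w n)) = norm (1 / \<kappa> u) * (norm e / real (Suc n)) / w n"
        using w by (simp only: norm_mult norm_divide norm_of_nat norm_of_real abs_of_pos)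
      also have "\<dots> \<le> 2 / r * (C * rsq (Suc n) ^ 2 / real (Suc n)) / w n"
        using elim(2) e w r by (intro divide_right_mono mult_mono) (auto simp: divide_right_mono)
      also have "rsq (Suc n) ^ 2 = 1 / (real n + 2)" by (simp add: rsq_power2 add.commute)
      also have "2 / r * (C * (1 / (real n + 2)) / real (Suc n)) / w n \<le> 2 / r * (C * (1 / real n) / real n) / w n"
        using C(1) r w n by (intro divide_right_mono mult_left_mono frac_le) (auto intro!: divide_left_mono)
      also have "\<dots> = (2 * C / r) * (1 / real n / real n / w n)" by simp
      also have "1 / real n / real n / w n = 1 / sqrt (real n)"
      proof -
        have "w n * (real n * real n) = real n powr (- (3 / 2)) * real n powr 2"
          using n by (simp add: w_def power2_eq_square)
        also have "\<dots> = real n powr (1 / 2)" unfolding powr_add[symmetric] by simp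
        also have "\<dots> = sqrt (real n)" by (simp add: powr_half_sqrt)
        finally show ?thesis by (simp add: mult_ac)
      qed
      finally show "norm (E n u) \<le> (2 * C / r + 3) / sqrt (real n)"
        by (simp add: add_divide_distrib)
    qed
  qed
  \<comment> \<open>The neighbourhood in \<open>main\<close> does not depend on \<open>n\<close>, so
    a single \<delta> works for all \<open>n\<close>.\<close>
  then obtain \<delta> where \<delta>: "\<delta> > 0" "\<And>u. dist u 1 < \<delta> \<Longrightarrow> \<forall>n\<ge>1. fps_nth (G_series k u) n =
      M u * (1 + 2 * csqrt (of_nat k * u)) ^ n * of_real (w n) * (1 + E n u) \<and>
      norm (E n u) \<le> (2 * C / r + 3) / sqrt (real n)"
    unfolding eventually_nhds_metric by blast
  have "\<forall>\<^sub>F n in sequentially. \<forall>u :: complex. norm (u - 1) < \<delta> \<longrightarrow>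
      fps_nth (G_series k u) n = M u * (1 + 2 * csqrt (of_nat k * u)) ^ n * of_real (w n) * (1 + E n u) \<and>
      norm (E n u) \<le> (2 * C / r + 3) / sqrt (real n)"
    using eventually_ge_at_top[of 1] by eventually_elim (use \<delta>(2) in \<open>simp add: dist_norm\<close>)
  with \<delta>(1) show ?thesis unfolding M_def w_def by blast
qed

end
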